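(* Let $\Theta$ be a set of formulas of first-order arithmetic. If there is a $\mathrm{CHA}$-proof of $\Gamma\Rightarrow\delta$ in which every bud and every companion is labelled by a sequent $\Gamma'\Rightarrow\delta'$ with $\Gamma'\cup\{\delta'\}\subseteq\Theta$, then there is an $\mathrm{HA}$-proof of $\Gamma\Rightarrow\delta$ in which every instance $\varphi(0),\forall x.\,\varphi(x)\to\varphi(Sx)\Rightarrow\varphi(s)$ of the induction axioms has $\varphi\in\Pi(\Theta\Rightarrow\Theta)$ or $\varphi$ a $\Delta_0$ (bounded) formula.
   Context: Language: terms from variables, $0,S,+,\cdot$; formulas from $s=t,\bot,\wedge,\vee,\to,\forall,\exists$. Abbreviations: $x<y:=\exists z.\,y=x+Sz$, $x\le y:=x<Sy$, $\forall x<t.\varphi:=\forall x.(x<t\to\varphi)$, $\exists x<t.\varphi:=\exists x.(x<t\wedge\varphi)$. Sequents $\Gamma\Rightarrow\delta$: finite set $\Gamma$, single formula $\delta$. $\mathrm{HA}$: sequent calculus with the standard intuitionistic rules (Ax, $\to$L/R, $\wedge$L/R, $\vee$L/R, $\forall$L/R, $\exists$L/R, $\bot$L, $=$L, $=$R), weakening, cut, arithmetic axioms ($\Rightarrow 0\neq St$, $Ss=St\Rightarrow s=t$, $\Rightarrow s+0=s$, $\Rightarrow s+St=S(s+t)$, $\Rightarrow s\cdot0=0$, $\Rightarrow s\cdot St=(s\cdot t)+s$) and induction axioms $\varphi(0),\forall x.\,\varphi(x)\to\varphi(Sx)\Rightarrow\varphi(s)$; proofs are finite trees. $\mathrm{CHA}$: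 rules of $\mathrm{HA}$ without induction axioms plus $\textsc{Case}_x$ (from $\Gamma[0/x]\Rightarrow\delta[0/x]$ and $\Gamma[Sx/x]\Rightarrow\delta[Sx/x]$ infer $\Gamma\Rightarrow\delta$). Pre-proofs are finite trees with a partial map $\beta$ sending some leaves (buds) to inner nodes (companions), non-bud nodes labelled by rule instances, each bud carrying its companion's sequent. An infinite branch starts at the root and moves to a child or from a bud to its companion. A $\mathrm{CHA}$-proof is a pre-proof such that along every infinite branch some variable $x$ is, from some point on, free in every sequent and the branch passes instances of $\textsc{Case}_x$ infinitely often. Operations on sets of formulas: $\Theta\Rightarrow\Theta:=\{(\bigwedge\Phi)\to\psi \mid \Phi\subseteq\Theta \text{ finite},\ \psi\in\Theta\}$; $\Pi(\Theta)$ is the smallest set of formulas containing $\Theta$ and closed under bounded quantification ($\varphi\in\Pi(\Theta)$, $t$ a term not containing $x$ imply $\forall x<t.\varphi,\exists x<t.\varphi\in\Pi(\Theta)$) and under unbounded universal quantification. *)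

theory Defs
  imports Main "HOL-Library.FSet"
begin

section \<open>Syntax\<close>

text \<open>
  Formulas are taken up to renaming of bound variables. This is achieved with de Bruijn indices:
  the variables are \<open>Var 0, Var 1, \<dots>\<close>, and the constructors \<open>Uni\<close> and \<open>Exi\<close> bind index \<open>0\<close> of their
  body. The named quantifiers \<open>\<forall>x. \<phi>\<close> and \<open>\<exists>x. \<phi>\<close> are the functions \<open>Forall x \<phi>\<close> and
  \<open>Exists x \<phi>\<close> below. Everything after this section is written with the named quantifiers only.
\<close>

type_synonym var = nat

datatype tm = Var var | Zero | Succ tm | Plus tm tm | Times tm tm

datatype fm = Eq tm tm | Bot | And fm fm | Or fm fm | Imp fm fm | Uni fm | Exi fm

primrec fv_tm :: "tm \<Rightarrow> var set" where
  "fv_tm (Var x) = {x}"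
| "fv_tm Zero = {}"
| "fv_tm (Succ s) = fv_tm s"
| "fv_tm (Plus s t) = fv_tm s \<union> fv_tm t"
| "fv_tm (Times s t) = fv_tm s \<union> fv_tm t"

primrec fv :: "fm \<Rightarrow> var set" where
  "fv (Eq s t) = fv_tm s \<union> fv_tm t"
| "fv Bot = {}"
| "fv (And \<phi> \<psi>) = fv \<phi> \<union> fv \<psi>"
| "fv (Or \<phi> \<psi>) = fv \<phi> \<union> fv \<psi>"
| "fv (Imp \<phi> \<psi>) = fv \<phi> \<union> fv \<psi>"
| "fv (Uni \<phi>) = {n. Suc n \<in> fv \<phi>}"
| "fv (Exi \<phi>) = {n. Suc n \<in> fv \<phi>}"

text \<open>Simultaneous capture-avoiding substitution.\<close>

primrec psubst_tm :: "(var \<Rightarrow> tm) \<Rightarrow> tm \<Rightarrow> tm" where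
  "psubst_tm \<sigma> (Var x) = \<sigma> x"
| "psubst_tm \<sigma> Zero = Zero"
| "psubst_tm \<sigma> (Succ s) = Succ (psubst_tm \<sigma> s)"
| "psubst_tm \<sigma> (Plus s t) = Plus (psubst_tm \<sigma> s) (psubst_tm \<sigma> t)"
| "psubst_tm \<sigma> (Times s t) = Times (psubst_tm \<sigma> s) (psubst_tm \<sigma> t)"

definition lift :: "tm \<Rightarrow> tm" where
  "lift t = psubst_tm (\<lambda>n. Var (Suc n)) t"

definition up :: "(var \<Rightarrow> tm) \<Rightarrow> var \<Rightarrow> tm" where
  "up \<sigma> n = (case n of 0 \<Rightarrow> Var 0 | Suc m \<Rightarrow> lift (\<sigma> m))"

primrec psubst :: "(var \<Rightarrow> tm) \<Rightarrow> fm \<Rightarrow> fm" where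
  "psubst \<sigma> (Eq s t) = Eq (psubst_tm \<sigma> s) (psubst_tm \<sigma> t)"
| "psubst \<sigma> Bot = Bot"
| "psubst \<sigma> (And \<phi> \<psi>) = And (psubst \<sigma> \<phi>) (psubst \<sigma> \<psi>)"
| "psubst \<sigma> (Or \<phi> \<psi>) = Or (psubst \<sigma> \<phi>) (psubst \<sigma> \<psi>)"
| "psubst \<sigma> (Imp \<phi> \<psi>) = Imp (psubst \<sigma> \<phi>) (psubst \<sigma> \<psi>)"
| "psubst \<sigma> (Uni \<phi>) = Uni (psubst (up \<sigma>) \<phi>)"
| "psubst \<sigma> (Exi \<phi>) = Exi (psubst (up \<sigma>) \<phi>)"

abbreviation subst :: "fm \<Rightarrow> tm \<Rightarrow> var \<Rightarrow> fm"  (\<open>_\<langle>_'/_\<rangle>\<close> [1000, 0, 0] 1000) where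
  "\<phi>\<langle>t/x\<rangle> \<equiv> psubst (Var(x := t)) \<phi>"

definition abstract :: "var \<Rightarrow> fm \<Rightarrow> fm" where
  "abstract x \<phi> = psubst (\<lambda>n. if n = x then Var 0 else Var (Suc n)) \<phi>"

definition Forall :: "var \<Rightarrow> fm \<Rightarrow> fm" where
  "Forall x \<phi> = Uni (abstract x \<phi>)"

definition Exists :: "var \<Rightarrow> fm \<Rightarrow> fm" where
  "Exists x \<phi> = Exi (abstract x \<phi>)"

text \<open>\<open>s < t\<close> is \<open>\<exists>z. t = s + Sz\<close> for a fresh \<open>z\<close>; see \<open>less_eq_Exists\<close>.\<close>

definition less_fm :: "tm \<Rightarrow> tm \<Rightarrow> fm" where
  "less_fm s t = Exi (Eq (lift t) (Plus (lift s) (Succ (Var 0))))"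

definition ForallLess :: "var \<Rightarrow> tm \<Rightarrow> fm \<Rightarrow> fm" where
  "ForallLess x t \<phi> = Forall x (Imp (less_fm (Var x) t) \<phi>)"

definition ExistsLess :: "var \<Rightarrow> tm \<Rightarrow> fm \<Rightarrow> fm" where
  "ExistsLess x t \<phi> = Exists x (And (less_fm (Var x) t) \<phi>)"

text \<open>The named quantifiers behave as they should.\<close>

lemma psubst_tm_comp: "psubst_tm \<sigma> (psubst_tm \<tau> t) = psubst_tm (\<lambda>n. psubst_tm \<sigma> (\<tau> n)) t"
  by (induction t) auto

lemma psubst_tm_cong: "(\<And>n. n \<in> fv_tm t \<Longrightarrow> \<sigma> n = \<tau> n) \<Longrightarrow> psubst_tm \<sigma> t = psubst_tm \<tau> t"
  by (induction t) auto

lemma psubst_tm_Var: "psubst_tm Var t = t"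
  by (induction t) auto

lemma psubst_cong: "(\<And>n. n \<in> fv \<phi> \<Longrightarrow> \<sigma> n = \<tau> n) \<Longrightarrow> psubst \<sigma> \<phi> = psubst \<tau> \<phi>"
proof (induction \<phi> arbitrary: \<sigma> \<tau>)
  case (Eq s t)
  then show ?case by (auto intro: psubst_tm_cong)
next
  case (Uni \<phi>)
  have "psubst (up \<sigma>) \<phi> = psubst (up \<tau>) \<phi>"
    by (rule Uni.IH) (use Uni.prems in \<open>auto simp: up_def split: nat.split\<close>)
  then show ?case by simp
next
  case (Exi \<phi>)
  have "psubst (up \<sigma>) \<phi> = psubst (up \<tau>) \<phi>"
    by (rule Exi.IH) (use Exi.prems in \<open>auto simp: up_def split: nat.split\<close>)
  then show ?case by simp
next
  case (And \<phi> \<psi>)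
  then show ?case by (metis UnCI fv.simps(3) psubst.simps(3))
next
  case (Or \<phi> \<psi>)
  then show ?case by (metis UnCI fv.simps(4) psubst.simps(4))
next
  case (Imp \<phi> \<psi>)
  then show ?case by (metis UnCI fv.simps(5) psubst.simps(5))
qed simp

lemma up_comp: "psubst_tm (up \<sigma>) (up \<tau> n) = up (\<lambda>n. psubst_tm \<sigma> (\<tau> n)) n"
  by (auto simp: up_def lift_def psubst_tm_comp split: nat.split)

lemma psubst_comp: "psubst \<sigma> (psubst \<tau> \<phi>) = psubst (\<lambda>n. psubst_tm \<sigma> (\<tau> n)) \<phi>"
  by (induction \<phi> arbitrary: \<sigma> \<tau>) (auto simp: psubst_tm_comp up_comp)

lemma up_Var: "up Var = Var"
  by (rule ext) (auto simp: up_def lift_def split: nat.split)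

lemma psubst_Var: "psubst Var \<phi> = \<phi>"
  by (induction \<phi>) (auto simp: psubst_tm_Var up_Var)

lemma fv_psubst_tm: "fv_tm (psubst_tm \<sigma> t) = (\<Union>n\<in>fv_tm t. fv_tm (\<sigma> n))"
  by (induction t) auto

lemma fv_lift: "fv_tm (lift t) = Suc ` fv_tm t"
  by (auto simp: lift_def fv_psubst_tm)

lemma fv_up: "{n. Suc n \<in> fv_tm (up \<sigma> m)} = (case m of 0 \<Rightarrow> {} | Suc k \<Rightarrow> fv_tm (\<sigma> k))"
  by (auto simp: up_def fv_lift split: nat.split)

lemma fv_psubst: "fv (psubst \<sigma> \<phi>) = (\<Union>n\<in>fv \<phi>. fv_tm (\<sigma> n))"
proof (induction \<phi> arbitrary: \<sigma>)
  have *: "{n. \<exists>m\<in>A. Suc n \<in> fv_tm (up \<sigma> m)} = (\<Union>n\<in>{n. Suc n \<in> A}. fv_tm (\<sigma> n))" for A \<sigma>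
  proof (intro set_eqI iffI)
    fix n assume "n \<in> {n. \<exists>m\<in>A. Suc n \<in> fv_tm (up \<sigma> m)}"
    then obtain m where "m \<in> A" "Suc n \<in> fv_tm (up \<sigma> m)" by auto
    then show "n \<in> (\<Union>n\<in>{n. Suc n \<in> A}. fv_tm (\<sigma> n))"
      by (cases m) (auto simp: up_def fv_lift)
  qed (auto simp: up_def fv_lift intro!: bexI)
  { case (Uni \<phi>) then show ?case using * by simp }
  { case (Exi \<phi>) then show ?case using * by simp }
qed (auto simp: fv_psubst_tm)

lemma fv_Forall: "fv (Forall x \<phi>) = fv \<phi> - {x}"
  by (auto simp: Forall_def abstract_def fv_psubst split: if_splits)

lemma fv_Exists: "fv (Exists x \<phi>) = fv \<phi> - {x}"
  by (auto simp: Exists_def abstract_def fv_psubst split: if_splits)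

lemma abstract_psubst:
  assumes "\<And>n. n \<in> fv \<phi> \<Longrightarrow> n \<noteq> x \<Longrightarrow> y \<notin> fv_tm (\<sigma> n)"
  shows "abstract y (psubst (\<sigma>(x := Var y)) \<phi>) = psubst (up \<sigma>) (abstract x \<phi>)"
  unfolding abstract_def psubst_comp
proof (rule psubst_cong)
  fix n assume "n \<in> fv \<phi>"
  then show "psubst_tm (\<lambda>n. if n = y then Var 0 else Var (Suc n)) ((\<sigma>(x := Var y)) n) =
      psubst_tm (up \<sigma>) (if n = x then Var 0 else Var (Suc n))"
    using assms[of n] by (auto simp: up_def lift_def intro!: psubst_tm_cong)
qed

lemma subst_Forall: "y \<noteq> x \<Longrightarrow> x \<notin> fv_tm t \<Longrightarrow> (Forall x \<phi>)\<langle>t/y\<rangle> = Forall x (\<phi>\<langle>t/y\<rangle>)"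
  using abstract_psubst[of \<phi> x x "Var(y := t)"]
  by (simp add: Forall_def fun_upd_twist fun_upd_idem)

lemma subst_Exists: "y \<noteq> x \<Longrightarrow> x \<notin> fv_tm t \<Longrightarrow> (Exists x \<phi>)\<langle>t/y\<rangle> = Exists x (\<phi>\<langle>t/y\<rangle>)"
  using abstract_psubst[of \<phi> x x "Var(y := t)"]
  by (simp add: Exists_def fun_upd_twist fun_upd_idem)

lemma Forall_rename: "y \<notin> fv (Forall x \<phi>) \<Longrightarrow> Forall y (\<phi>\<langle>Var y/x\<rangle>) = Forall x \<phi>"
  unfolding fv_Forall using abstract_psubst[of \<phi> x y Var] by (auto simp: up_Var psubst_Var Forall_def)

lemma Exists_rename: "y \<notin> fv (Exists x \<phi>) \<Longrightarrow> Exists y (\<phi>\<langle>Var y/x\<rangle>) = Exists x \<phi>"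
  unfolding fv_Exists using abstract_psubst[of \<phi> x y Var] by (auto simp: up_Var psubst_Var Exists_def)

lemma abstract_surj:
  assumes "Suc x \<notin> fv \<phi>"
  shows "\<phi> = abstract x (psubst (case_nat (Var x) Var) \<phi>)"
proof -
  have "abstract x (psubst (case_nat (Var x) Var) \<phi>) = psubst Var \<phi>"
    unfolding abstract_def psubst_comp
    by (rule psubst_cong) (use assms in \<open>auto split: nat.split\<close>)
  then show ?thesis by (simp add: psubst_Var)
qed

lemma Uni_is_Forall: "x \<notin> fv (Uni \<phi>) \<Longrightarrow> \<exists>\<psi>. Uni \<phi> = Forall x \<psi>"
  using abstract_surj by (auto simp: Forall_def)

lemma Exi_is_Exists: "x \<notin> fv (Exi \<phi>) \<Longrightarrow> \<exists>\<psi>. Exi \<phi> = Exists x \<psi>"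
  using abstract_surj by (auto simp: Exists_def)

lemma less_eq_Exists:
  assumes "z \<notin> fv_tm s" "z \<notin> fv_tm t"
  shows "less_fm s t = Exists z (Eq t (Plus s (Succ (Var z))))"
  using assms by (auto simp: less_fm_def Exists_def abstract_def lift_def intro!: psubst_tm_cong)

section \<open>Sequents and rules\<close>

type_synonym sequent = "fm fset \<times> fm"

abbreviation Sequent :: "fm fset \<Rightarrow> fm \<Rightarrow> sequent"  (infix \<open>\<turnstile>\<close> 50) where
  "\<Gamma> \<turnstile> \<delta> \<equiv> (\<Gamma>, \<delta>)"

definition fvs :: "fm fset \<Rightarrow> var set" where
  "fvs \<Gamma> = (\<Union>\<phi>\<in>fset \<Gamma>. fv \<phi>)"

definition fv_sequent :: "sequent \<Rightarrow> var set" where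
  "fv_sequent S = fvs (fst S) \<union> fv (snd S)"

datatype rule =
    Ax | ImpL | ImpR | AndL | AndR | OrL | OrR1 | OrR2 | AllL | AllR | ExL | ExR | BotL | EqL | EqR
  | Wk | Cut
  | Zero_neq_Succ | Succ_inj | Plus_Zero | Plus_Succ | Times_Zero | Times_Succ
  | Ind var fm
  | Case var

text \<open>
  \<open>rule_instance r Ps S\<close>: the premises \<open>Ps\<close> (in order) and the conclusion \<open>S\<close> form an instance of
  rule \<open>r\<close>. In \<open>AllR\<close> and \<open>ExL\<close>, \<open>y\<close> is the eigenvariable. In \<open>EqL\<close>, \<open>s\<close> and \<open>t\<close> are exchanged
  simultaneously at any chosen occurrences, marked by \<open>x\<close> and \<open>y\<close>.
\<close>

inductive rule_instance :: "rule \<Rightarrow> sequent list \<Rightarrow> sequent \<Rightarrow> bool" where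
  "rule_instance Ax [] (finsert \<delta> \<Gamma> \<turnstile> \<delta>)"
| "rule_instance ImpL [\<Gamma> \<turnstile> \<phi>, finsert \<psi> \<Gamma> \<turnstile> \<delta>] (finsert (Imp \<phi> \<psi>) \<Gamma> \<turnstile> \<delta>)"
| "rule_instance ImpR [finsert \<phi> \<Gamma> \<turnstile> \<psi>] (\<Gamma> \<turnstile> Imp \<phi> \<psi>)"
| "rule_instance AndL [finsert \<phi> (finsert \<psi> \<Gamma>) \<turnstile> \<delta>] (finsert (And \<phi> \<psi>) \<Gamma> \<turnstile> \<delta>)"
| "rule_instance AndR [\<Gamma> \<turnstile> \<phi>, \<Gamma> \<turnstile> \<psi>] (\<Gamma> \<turnstile> And \<phi> \<psi>)"
| "rule_instance OrL [finsert \<phi> \<Gamma> \<turnstile> \<delta>, finsert \<psi> \<Gamma> \<turnstile> \<delta>] (finsert (Or \<phi> \<psi>) \<Gamma> \<turnstile> \<delta>)"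
| "rule_instance OrR1 [\<Gamma> \<turnstile> \<phi>] (\<Gamma> \<turnstile> Or \<phi> \<psi>)"
| "rule_instance OrR2 [\<Gamma> \<turnstile> \<psi>] (\<Gamma> \<turnstile> Or \<phi> \<psi>)"
| "rule_instance AllL [finsert (\<phi>\<langle>t/x\<rangle>) \<Gamma> \<turnstile> \<delta>] (finsert (Forall x \<phi>) \<Gamma> \<turnstile> \<delta>)"
| "y \<notin> fvs \<Gamma> \<union> fv (Forall x \<phi>) \<Longrightarrow>
    rule_instance AllR [\<Gamma> \<turnstile> \<phi>\<langle>Var y/x\<rangle>] (\<Gamma> \<turnstile> Forall x \<phi>)"
| "y \<notin> fvs \<Gamma> \<union> fv (Exists x \<phi>) \<union> fv \<delta> \<Longrightarrow>
    rule_instance ExL [finsert (\<phi>\<langle>Var y/x\<rangle>) \<Gamma> \<turnstile> \<delta>] (finsert (Exists x \<phi>) \<Gamma> \<turnstile> \<delta>)"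
| "rule_instance ExR [\<Gamma> \<turnstile> \<phi>\<langle>t/x\<rangle>] (\<Gamma> \<turnstile> Exists x \<phi>)"
| "rule_instance BotL [] (finsert Bot \<Gamma> \<turnstile> \<delta>)"
| "x \<noteq> y \<Longrightarrow>
    rule_instance EqL
      [psubst (Var(x := s, y := t)) |`| \<Gamma> \<turnstile> psubst (Var(x := s, y := t)) \<delta>]
      (finsert (Eq s t) (psubst (Var(x := t, y := s)) |`| \<Gamma>) \<turnstile> psubst (Var(x := t, y := s)) \<delta>)"
| "rule_instance EqR [] (\<Gamma> \<turnstile> Eq t t)"
| "rule_instance Wk [\<Gamma> \<turnstile> \<delta>] (\<Gamma> |\<union>| \<Gamma>' \<turnstile> \<delta>)"
| "rule_instance Cut [\<Gamma> \<turnstile> \<phi>, finsert \<phi> \<Gamma> \<turnstile> \<delta>] (\<Gamma> \<turnstile> \<delta>)"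
| "rule_instance Zero_neq_Succ [] ({||} \<turnstile> Imp (Eq Zero (Succ t)) Bot)"
| "rule_instance Succ_inj [] ({|Eq (Succ s) (Succ t)|} \<turnstile> Eq s t)"
| "rule_instance Plus_Zero [] ({||} \<turnstile> Eq (Plus s Zero) s)"
| "rule_instance Plus_Succ [] ({||} \<turnstile> Eq (Plus s (Succ t)) (Succ (Plus s t)))"
| "rule_instance Times_Zero [] ({||} \<turnstile> Eq (Times s Zero) Zero)"
| "rule_instance Times_Succ [] ({||} \<turnstile> Eq (Times s (Succ t)) (Plus (Times s t) s))"
| "rule_instance (Ind x \<phi>) []
    ({|\<phi>\<langle>Zero/x\<rangle>, Forall x (Imp \<phi> (\<phi>\<langle>Succ (Var x)/x\<rangle>))|} \<turnstile> \<phi>\<langle>s/x\<rangle>)"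
| "rule_instance (Case x)
    [(\<lambda>\<phi>. \<phi>\<langle>Zero/x\<rangle>) |`| \<Gamma> \<turnstile> \<delta>\<langle>Zero/x\<rangle>,
     (\<lambda>\<phi>. \<phi>\<langle>Succ (Var x)/x\<rangle>) |`| \<Gamma> \<turnstile> \<delta>\<langle>Succ (Var x)/x\<rangle>]
    (\<Gamma> \<turnstile> \<delta>)"

definition HA_rules :: "rule set" where
  "HA_rules = UNIV - range Case"

definition CHA_rules :: "rule set" where
  "CHA_rules = UNIV - {Ind x \<phi> | x \<phi>. True}"

section \<open>Proofs\<close>

datatype ptree = Bud sequent | Infer rule sequent "ptree list"

primrec concl :: "ptree \<Rightarrow> sequent" where
  "concl (Bud S) = S"
| "concl (Infer r S Ts) = S"

text \<open>Nodes are addressed by the list of child indices leading to them from the root.\<close>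

type_synonym pos = "nat list"

fun node_at :: "ptree \<Rightarrow> pos \<Rightarrow> ptree option" where
  "node_at T [] = Some T"
| "node_at (Bud S) (i # p) = None"
| "node_at (Infer r S Ts) (i # p) = (if i < length Ts then node_at (Ts ! i) p else None)"

definition sequent_at :: "ptree \<Rightarrow> pos \<Rightarrow> sequent" where
  "sequent_at T p = concl (the (node_at T p))"

definition locally_correct :: "rule set \<Rightarrow> ptree \<Rightarrow> bool" where
  "locally_correct R T \<longleftrightarrow>
    (\<forall>p r S Ts. node_at T p = Some (Infer r S Ts) \<longrightarrow>
      r \<in> R \<and> rule_instance r (map concl Ts) S)"

definition buds :: "ptree \<Rightarrow> pos set" where
  "buds T = {p. \<exists>S. node_at T p = Some (Bud S)}"

definition inner_nodes :: "ptree \<Rightarrow> pos set" where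
  "inner_nodes T = {p. \<exists>r S Ts. node_at T p = Some (Infer r S Ts) \<and> Ts \<noteq> []}"

definition HA_proof :: "ptree \<Rightarrow> bool" where
  "HA_proof T \<longleftrightarrow> buds T = {} \<and> locally_correct HA_rules T"

definition induction_formulas :: "ptree \<Rightarrow> fm set" where
  "induction_formulas T = {\<phi>. \<exists>p x S Ts. node_at T p = Some (Infer (Ind x \<phi>) S Ts)}"

definition CHA_preproof :: "ptree \<Rightarrow> (pos \<rightharpoonup> pos) \<Rightarrow> bool" where
  "CHA_preproof T \<beta> \<longleftrightarrow>
    locally_correct CHA_rules T \<and>
    dom \<beta> = buds T \<and> ran \<beta> \<subseteq> inner_nodes T \<and>
    (\<forall>p q. \<beta> p = Some q \<longrightarrow> sequent_at T p = sequent_at T q)"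

definition infinite_branch :: "ptree \<Rightarrow> (pos \<rightharpoonup> pos) \<Rightarrow> (nat \<Rightarrow> pos) \<Rightarrow> bool" where
  "infinite_branch T \<beta> b \<longleftrightarrow>
    b 0 = [] \<and>
    (\<forall>n. (\<exists>i. b (Suc n) = b n @ [i] \<and> node_at T (b (Suc n)) \<noteq> None) \<or>
         \<beta> (b n) = Some (b (Suc n)))"

definition CHA_proof :: "ptree \<Rightarrow> (pos \<rightharpoonup> pos) \<Rightarrow> bool" where
  "CHA_proof T \<beta> \<longleftrightarrow>
    CHA_preproof T \<beta> \<and>
    (\<forall>b. infinite_branch T \<beta> b \<longrightarrow>
      (\<exists>x. (\<exists>N. \<forall>n\<ge>N. x \<in> fv_sequent (sequent_at T (b n))) \<and>
           (\<forall>N. \<exists>n\<ge>N. \<exists>S Ts. node_at T (b n) = Some (Infer (Case x) S Ts))))"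

section \<open>Classes of formulas\<close>

text \<open>
  The conjunction of a finite set is formed along an arbitrary but fixed enumeration without
  repetitions; the empty conjunction is \<open>\<bottom> \<rightarrow> \<bottom>\<close>.
\<close>

fun conj_list :: "fm list \<Rightarrow> fm" where
  "conj_list [] = Imp Bot Bot"
| "conj_list [\<phi>] = \<phi>"
| "conj_list (\<phi> # \<psi> # \<phi>s) = And \<phi> (conj_list (\<psi> # \<phi>s))"

definition conj_set :: "fm set \<Rightarrow> fm" where
  "conj_set \<Phi> = conj_list (SOME \<phi>s. set \<phi>s = \<Phi> \<and> distinct \<phi>s)"

text \<open>The set written \<open>\<Theta> \<Rightarrow> \<Theta>\<close> on paper.\<close>

definition sequent_formulas :: "fm set \<Rightarrow> fm set" where
  "sequent_formulas \<Theta> = {Imp (conj_set \<Phi>) \<psi> | \<Phi> \<psi>. finite \<Phi> \<and> \<Phi> \<subseteq> \<Theta> \<and> \<psi> \<in> \<Theta>}"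

inductive_set Pi_closure :: "fm set \<Rightarrow> fm set" for \<Theta> :: "fm set" where
  "\<phi> \<in> \<Theta> \<Longrightarrow> \<phi> \<in> Pi_closure \<Theta>"
| "\<phi> \<in> Pi_closure \<Theta> \<Longrightarrow> x \<notin> fv_tm t \<Longrightarrow> ForallLess x t \<phi> \<in> Pi_closure \<Theta>"
| "\<phi> \<in> Pi_closure \<Theta> \<Longrightarrow> x \<notin> fv_tm t \<Longrightarrow> ExistsLess x t \<phi> \<in> Pi_closure \<Theta>"
| "\<phi> \<in> Pi_closure \<Theta> \<Longrightarrow> Forall x \<phi> \<in> Pi_closure \<Theta>"

inductive_set Delta0 :: "fm set" where
  "Eq s t \<in> Delta0"
| "Bot \<in> Delta0"
| "\<phi> \<in> Delta0 \<Longrightarrow> \<psi> \<in> Delta0 \<Longrightarrow> And \<phi> \<psi> \<in> Delta0"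
| "\<phi> \<in> Delta0 \<Longrightarrow> \<psi> \<in> Delta0 \<Longrightarrow> Or \<phi> \<psi> \<in> Delta0"
| "\<phi> \<in> Delta0 \<Longrightarrow> \<psi> \<in> Delta0 \<Longrightarrow> Imp \<phi> \<psi> \<in> Delta0"
| "\<phi> \<in> Delta0 \<Longrightarrow> x \<notin> fv_tm t \<Longrightarrow> ForallLess x t \<phi> \<in> Delta0"
| "\<phi> \<in> Delta0 \<Longrightarrow> x \<notin> fv_tm t \<Longrightarrow> ExistsLess x t \<phi> \<in> Delta0"

end

theory Submission
  imports Defs
begin

text \<open>
  In a strongly connected set \<open>R\<close> of nodes of a cyclic proof, the branch visiting all of \<open>R\<close> forever
  yields a variable \<open>x\<close> that is free throughout \<open>R\<close> and decreases at some \<open>Case\<^sub>x\<close> node of \<open>R\<close>. All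
  sequents of \<open>R\<close> then follow by simultaneous strong induction on \<open>x\<close>: after a \<open>Case\<^sub>x\<close> step, the first
  companion of \<open>R\<close> that is reached is covered by the induction hypothesis, and deleting the \<open>Case\<^sub>x\<close> nodes
  from \<open>R\<close> leaves a smaller set of nodes in which the value of \<open>x\<close> is fixed.

  Since \<open>\<Pi>(\<Theta> \<Rightarrow> \<Theta>)\<close> is not closed under conjunction, simultaneous induction over several companions has
  to be reduced to nested inductions on single formulas \<open>Q(z) = \<forall>x<z. \<phi>\<close>, where the inner ones are only
  valid up to the bound \<open>a\<close> of the outer hypotheses. Such a bounded induction is an induction on
  \<open>Q(z) \<or> Q(a)\<close>, and this disjunction is expressible in \<open>\<Pi>(\<Theta> \<Rightarrow> \<Theta>)\<close> by bounded existential quantifiers: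
  \<open>\<exists>p<2. \<exists>q<2. \<exists>r<p+q. \<forall>x<z\<cdot>p+a\<cdot>q. \<phi>\<close>.
\<close>

section \<open>Substitution and free variables\<close>

lemma psubst_tm_idle: "x \<notin> fv_tm s \<Longrightarrow> psubst_tm (Var(x := t)) s = s"
  by (subst psubst_tm_cong[of s _ Var]) (auto simp: psubst_tm_Var)

lemma psubst_idle: "x \<notin> fv \<phi> \<Longrightarrow> \<phi>\<langle>t/x\<rangle> = \<phi>"
  by (subst psubst_cong[of \<phi> _ Var]) (auto simp: psubst_Var)

lemma psubst_less: "psubst \<sigma> (less_fm s t) = less_fm (psubst_tm \<sigma> s) (psubst_tm \<sigma> t)"
  by (simp add: less_fm_def lift_def up_def psubst_tm_comp)

lemma fv_less: "fv (less_fm s t) = fv_tm s \<union> fv_tm t"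
  by (auto simp: less_fm_def fv_lift)

lemma finite_fv_tm: "finite (fv_tm t)"
  by (induction t) auto

lemma finite_fv: "finite (fv \<phi>)"
proof (induction \<phi>)
  case (Uni \<phi>)
  have "Suc ` {n. Suc n \<in> fv \<phi>} \<subseteq> fv \<phi>" by auto
  then show ?case using Uni by (simp, meson finite_imageD finite_subset inj_Suc inj_on_subset subset_UNIV)
next
  case (Exi \<phi>)
  have "Suc ` {n. Suc n \<in> fv \<phi>} \<subseteq> fv \<phi>" by auto
  then show ?case using Exi by (simp, meson finite_imageD finite_subset inj_Suc inj_on_subset subset_UNIV)
qed (auto simp: finite_fv_tm)

lemma fvs_empty [simp]: "fvs {||} = {}"
  and fvs_finsert [simp]: "fvs (finsert \<phi> \<Gamma>) = fv \<phi> \<union> fvs \<Gamma>"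
  and fvs_funion [simp]: "fvs (\<Gamma> |\<union>| \<Gamma>') = fvs \<Gamma> \<union> fvs \<Gamma>'"
  by (auto simp: fvs_def)

lemma finite_fvs: "finite (fvs \<Gamma>)"
  by (simp add: fvs_def finite_fv)

lemma fresh_var: "finite A \<Longrightarrow> \<exists>y::var. y \<notin> A"
  by (rule ex_new_if_finite) auto

lemma psubst_fimage_idle: "x \<notin> fvs \<Gamma> \<Longrightarrow> (\<lambda>\<phi>. \<phi>\<langle>t/x\<rangle>) |`| \<Gamma> = \<Gamma>"
  using fset.map_cong0[of \<Gamma> "\<lambda>\<phi>. \<phi>\<langle>t/x\<rangle>" "\<lambda>\<phi>. \<phi>"] by (auto simp: fvs_def psubst_idle)

lemma psubst_fimage_Var [simp]: "psubst Var |`| \<Gamma> = \<Gamma>"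
  using fset.map_cong0[of \<Gamma> "psubst Var" "\<lambda>\<phi>. \<phi>"] by (auto simp: psubst_Var)

lemma fv_ForallLess: "fv (ForallLess x t \<phi>) = (fv_tm t \<union> fv \<phi>) - {x}"
  by (auto simp: ForallLess_def fv_Forall fv_less)

lemma subst_ForallLess:
  "y \<noteq> x \<Longrightarrow> x \<notin> fv_tm s \<Longrightarrow>
    (ForallLess x t \<phi>)\<langle>s/y\<rangle> = ForallLess x (psubst_tm (Var(y := s)) t) (\<phi>\<langle>s/y\<rangle>)"
  by (simp add: ForallLess_def subst_Forall psubst_less)

lemma subst_ExistsLess:
  "y \<noteq> x \<Longrightarrow> x \<notin> fv_tm s \<Longrightarrow>
    (ExistsLess x t \<phi>)\<langle>s/y\<rangle> = ExistsLess x (psubst_tm (Var(y := s)) t) (\<phi>\<langle>s/y\<rangle>)"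
  by (simp add: ExistsLess_def subst_Exists psubst_less)

section \<open>Derivability with restricted induction\<close>

text \<open>Derivability is kept apart from trees and positions, which matter only when a finished
  proof is handed over. The parameter \<open>I\<close> collects the admissible induction
  formulas.\<close>

inductive derivable :: "fm set \<Rightarrow> sequent \<Rightarrow> bool" for I where
  infer: "rule_instance r Ps S \<Longrightarrow> r \<in> HA_rules \<Longrightarrow> (\<And>x \<phi>. r = Ind x \<phi> \<Longrightarrow> \<phi> \<in> I) \<Longrightarrow>
    (\<And>P. P \<in> set Ps \<Longrightarrow> derivable I P) \<Longrightarrow> derivable I S"

text \<open>A tree is chosen for every premise. A node of the assembled tree is the root or a node
  of one of these subtrees, so local correctness, absence of buds and the bound on induction
  formulas are inherited.\<close>

lemma derivable_HA_proof:
  assumes "derivable I S"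
  shows "\<exists>H. HA_proof H \<and> concl H = S \<and> induction_formulas H \<subseteq> I"
  using assms
proof induction
  case (infer r Ps S)
  then obtain h where h: "\<And>P. P \<in> set Ps \<Longrightarrow> HA_proof (h P) \<and> concl (h P) = P \<and> induction_formulas (h P) \<subseteq> I"
    by metis
  let ?Hs = "map h Ps"
  have concl: "map concl ?Hs = Ps" using h by (simp add: map_idI)
  have at: "node_at (Infer r S ?Hs) p = Some t \<Longrightarrow>
      (p = [] \<and> t = Infer r S ?Hs) \<or> (\<exists>P q. P \<in> set Ps \<and> node_at (h P) q = Some t)" for p t
    by (cases p) (auto split: if_splits dest: nth_mem[of _ Ps] simp del: split_paired_Ex)
  have "HA_proof (Infer r S ?Hs)"
    unfolding HA_proof_def
  proof
    show "buds (Infer r S ?Hs) = {}"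
      using at h unfolding buds_def HA_proof_def by blast
    show "locally_correct HA_rules (Infer r S ?Hs)"
      unfolding locally_correct_def
    proof (intro allI impI)
      fix p r' S' Ts assume "node_at (Infer r S ?Hs) p = Some (Infer r' S' Ts)"
      from at[OF this] show "r' \<in> HA_rules \<and> rule_instance r' (map concl Ts) S'"
      proof
        assume "p = [] \<and> Infer r' S' Ts = Infer r S ?Hs"
        then show ?thesis using infer.hyps concl by simp
      next
        assume "\<exists>P q. P \<in> set Ps \<and> node_at (h P) q = Some (Infer r' S' Ts)"
        then show ?thesis using h unfolding HA_proof_def locally_correct_def by blast
      qed
    qed
  qed
  moreover have "induction_formulas (Infer r S ?Hs) \<subseteq> I"
  proof
    fix \<phi> assume "\<phi> \<in> induction_formulas (Infer r S ?Hs)"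
    then obtain p x S' Ts where "node_at (Infer r S ?Hs) p = Some (Infer (Ind x \<phi>) S' Ts)"
      by (auto simp: induction_formulas_def)
    from at[OF this] show "\<phi> \<in> I"
      using infer.hyps(3) h unfolding induction_formulas_def by blast
  qed
  ultimately show ?case by (metis concl.simps(2))
qed

text \<open>Elementary arithmetic (laws of addition, case distinction, trichotomy) is developed with
  bounded induction formulas only, so all of \<open>Delta0\<close> has to be admissible.\<close>

locale restricted_HA =
  fixes I :: "fm set"
  assumes Delta0_subset: "Delta0 \<subseteq> I"
begin

abbreviation prv :: "fm fset \<Rightarrow> fm \<Rightarrow> bool"  (infix \<open>\<tturnstile>\<close> 45) where
  "\<Gamma> \<tturnstile> \<delta> \<equiv> derivable I (\<Gamma> \<turnstile> \<delta>)"

section \<open>Structural rules, connectives and quantifiers in natural-deduction style\<close>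

lemma by_rule:
  assumes "rule_instance r Ps S" "r \<in> HA_rules" "\<And>x \<phi>. r \<noteq> Ind x \<phi>" "\<And>P. P \<in> set Ps \<Longrightarrow> derivable I P"
  shows "derivable I S"
  using assms by (blast intro: derivable.infer)

lemma wk: "\<Gamma> \<tturnstile> \<delta> \<Longrightarrow> \<Gamma> |\<subseteq>| \<Gamma>' \<Longrightarrow> \<Gamma>' \<tturnstile> \<delta>"
  using by_rule[OF rule_instance.intros(16)[of \<Gamma> \<delta> \<Gamma>']] by (auto simp: HA_rules_def sup.absorb2)

lemma ax: "\<delta> |\<in>| \<Gamma> \<Longrightarrow> \<Gamma> \<tturnstile> \<delta>"
  using by_rule[OF rule_instance.intros(1)[of \<delta> \<Gamma>]] by (auto simp: HA_rules_def finsert_absorb)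

lemma cut: "\<Gamma> \<tturnstile> \<phi> \<Longrightarrow> finsert \<phi> \<Gamma> \<tturnstile> \<delta> \<Longrightarrow> \<Gamma> \<tturnstile> \<delta>"
  by (rule by_rule[OF rule_instance.intros(17)]) (auto simp: HA_rules_def)

lemma ImpI: "finsert \<phi> \<Gamma> \<tturnstile> \<psi> \<Longrightarrow> \<Gamma> \<tturnstile> Imp \<phi> \<psi>"
  by (rule by_rule[OF rule_instance.intros(3)]) (auto simp: HA_rules_def)

lemma ImpL: "\<Gamma> \<tturnstile> \<phi> \<Longrightarrow> finsert \<psi> \<Gamma> \<tturnstile> \<delta> \<Longrightarrow> finsert (Imp \<phi> \<psi>) \<Gamma> \<tturnstile> \<delta>"
  by (rule by_rule[OF rule_instance.intros(2)]) (auto simp: HA_rules_def)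

lemma ImpE: "\<Gamma> \<tturnstile> Imp \<phi> \<psi> \<Longrightarrow> \<Gamma> \<tturnstile> \<phi> \<Longrightarrow> \<Gamma> \<tturnstile> \<psi>"
  by (erule cut, rule ImpL) (auto intro: ax)

lemma AndI: "\<Gamma> \<tturnstile> \<phi> \<Longrightarrow> \<Gamma> \<tturnstile> \<psi> \<Longrightarrow> \<Gamma> \<tturnstile> And \<phi> \<psi>"
  by (rule by_rule[OF rule_instance.intros(5)]) (auto simp: HA_rules_def)

lemma AndL: "finsert \<phi> (finsert \<psi> \<Gamma>) \<tturnstile> \<delta> \<Longrightarrow> finsert (And \<phi> \<psi>) \<Gamma> \<tturnstile> \<delta>"
  by (rule by_rule[OF rule_instance.intros(4)]) (auto simp: HA_rules_def)

lemma AndD1: "\<Gamma> \<tturnstile> And \<phi> \<psi> \<Longrightarrow> \<Gamma> \<tturnstile> \<phi>"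
  by (erule cut, rule AndL) (auto intro: ax)

lemma AndD2: "\<Gamma> \<tturnstile> And \<phi> \<psi> \<Longrightarrow> \<Gamma> \<tturnstile> \<psi>"
  by (erule cut, rule AndL) (auto intro: ax)

lemma OrI1: "\<Gamma> \<tturnstile> \<phi> \<Longrightarrow> \<Gamma> \<tturnstile> Or \<phi> \<psi>"
  by (rule by_rule[OF rule_instance.intros(7)]) (auto simp: HA_rules_def)

lemma OrI2: "\<Gamma> \<tturnstile> \<psi> \<Longrightarrow> \<Gamma> \<tturnstile> Or \<phi> \<psi>"
  by (rule by_rule[OF rule_instance.intros(8)]) (auto simp: HA_rules_def)

lemma OrL: "finsert \<phi> \<Gamma> \<tturnstile> \<delta> \<Longrightarrow> finsert \<psi> \<Gamma> \<tturnstile> \<delta> \<Longrightarrow> finsert (Or \<phi> \<psi>) \<Gamma> \<tturnstile> \<delta>"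
  by (rule by_rule[OF rule_instance.intros(6)]) (auto simp: HA_rules_def)

lemma OrE: "\<Gamma> \<tturnstile> Or \<phi> \<psi> \<Longrightarrow> finsert \<phi> \<Gamma> \<tturnstile> \<delta> \<Longrightarrow> finsert \<psi> \<Gamma> \<tturnstile> \<delta> \<Longrightarrow> \<Gamma> \<tturnstile> \<delta>"
  by (erule cut, rule OrL)

lemma BotE: "\<Gamma> \<tturnstile> Bot \<Longrightarrow> \<Gamma> \<tturnstile> \<delta>"
  by (erule cut, rule by_rule[OF rule_instance.intros(13)]) (auto simp: HA_rules_def)

lemma AllI:
  assumes "\<Gamma> \<tturnstile> \<phi>\<langle>Var y/x\<rangle>" "y \<notin> fvs \<Gamma>" "y \<notin> fv (Forall x \<phi>)"
  shows "\<Gamma> \<tturnstile> Forall x \<phi>"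
  by (rule by_rule[OF rule_instance.intros(10)[of y]]) (use assms in \<open>auto simp: HA_rules_def\<close>)

lemma AllI_same: "\<Gamma> \<tturnstile> \<phi> \<Longrightarrow> x \<notin> fvs \<Gamma> \<Longrightarrow> \<Gamma> \<tturnstile> Forall x \<phi>"
  by (rule AllI[of _ _ x]) (auto simp: psubst_Var fv_Forall)

lemma AllL: "finsert (\<phi>\<langle>t/x\<rangle>) \<Gamma> \<tturnstile> \<delta> \<Longrightarrow> finsert (Forall x \<phi>) \<Gamma> \<tturnstile> \<delta>"
  by (rule by_rule[OF rule_instance.intros(9)]) (auto simp: HA_rules_def)

lemma AllE: "\<Gamma> \<tturnstile> Forall x \<phi> \<Longrightarrow> \<Gamma> \<tturnstile> \<phi>\<langle>t/x\<rangle>"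
  by (erule cut, rule AllL) (auto intro: ax)

lemma ExI: "\<Gamma> \<tturnstile> \<phi>\<langle>t/x\<rangle> \<Longrightarrow> \<Gamma> \<tturnstile> Exists x \<phi>"
  by (rule by_rule[OF rule_instance.intros(12)]) (auto simp: HA_rules_def)

lemma ExL:
  assumes "finsert (\<phi>\<langle>Var y/x\<rangle>) \<Gamma> \<tturnstile> \<delta>" "y \<notin> fvs \<Gamma> \<union> fv (Exists x \<phi>) \<union> fv \<delta>"
  shows "finsert (Exists x \<phi>) \<Gamma> \<tturnstile> \<delta>"
  by (rule by_rule[OF rule_instance.intros(11)[of y]]) (use assms in \<open>auto simp: HA_rules_def\<close>)

lemma ExE:
  assumes "\<Gamma> \<tturnstile> Exists x \<phi>" "finite A"
    and "\<And>y. y \<notin> A \<union> fvs \<Gamma> \<union> fv \<delta> \<Longrightarrow> finsert (\<phi>\<langle>Var y/x\<rangle>) \<Gamma> \<tturnstile> \<delta>"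
  shows "\<Gamma> \<tturnstile> \<delta>"
proof -
  obtain y where "y \<notin> A \<union> fvs \<Gamma> \<union> fv (Exists x \<phi>) \<union> fv \<delta>"
    using fresh_var[of "A \<union> fvs \<Gamma> \<union> fv (Exists x \<phi>) \<union> fv \<delta>"] assms(2) by (auto simp: finite_fv finite_fvs)
  then show ?thesis by (intro cut[OF assms(1)] ExL[of _ y] assms(3)) auto
qed

section \<open>Equality: replacement, congruence, and admissibility of substitution\<close>

lemma EqI: "\<Gamma> \<tturnstile> Eq t t"
  by (rule by_rule[OF rule_instance.intros(15)]) (auto simp: HA_rules_def)

text \<open>The marks are first renamed away from \<open>\<Delta>\<close>.\<close>

lemma eqL2:
  assumes "x \<noteq> y" "(psubst (Var(x := s, y := t)) |`| \<Gamma>) |\<union>| \<Delta> \<tturnstile> psubst (Var(x := s, y := t)) \<delta>"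
  shows "finsert (Eq s t) ((psubst (Var(x := t, y := s)) |`| \<Gamma>) |\<union>| \<Delta>) \<tturnstile> psubst (Var(x := t, y := s)) \<delta>"
proof -
  let ?A = "{x, y} \<union> fvs \<Gamma> \<union> fvs \<Delta> \<union> fv \<delta>"
  have fin: "finite ?A" by (simp add: finite_fv finite_fvs)
  obtain x' where x': "x' \<notin> ?A" using fresh_var[OF fin] by auto
  obtain y' where y': "y' \<notin> insert x' ?A" using fresh_var[of "insert x' ?A"] fin by auto
  let ?\<rho> = "Var(x := Var x', y := Var y')"
  let ?\<Gamma>' = "(psubst ?\<rho> |`| \<Gamma>) |\<union>| \<Delta>"
  have ren: "psubst (Var(x' := a, y' := b)) (psubst ?\<rho> \<phi>) = psubst (Var(x := a, y := b)) \<phi>"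
    if "fv \<phi> \<subseteq> ?A" for \<phi> a b
    unfolding psubst_comp by (rule psubst_cong) (use that x' y' \<open>x \<noteq> y\<close> in auto)
  have idle: "psubst (Var(x' := a, y' := b)) \<phi> = \<phi>" if "\<phi> |\<in>| \<Delta>" for \<phi> a b
    by (subst psubst_cong[of \<phi> _ Var]) (use x' y' that in \<open>auto simp: psubst_Var fvs_def\<close>)
  have sub: "fv \<phi> \<subseteq> ?A" if "\<phi> |\<in>| \<Gamma>" for \<phi>
    using that by (auto simp: fvs_def)
  have sub\<delta>: "fv \<delta> \<subseteq> ?A" by auto
  have img: "psubst (Var(x' := a, y' := b)) |`| ?\<Gamma>' = (psubst (Var(x := a, y := b)) |`| \<Gamma>) |\<union>| \<Delta>" for a b
  proof -
    have "psubst (Var(x' := a, y' := b)) |`| psubst ?\<rho> |`| \<Gamma> = psubst (Var(x := a, y := b)) |`| \<Gamma>"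
      unfolding fset.map_comp by (rule fset.map_cong0) (simp only: comp_apply ren[OF sub])
    moreover have "psubst (Var(x' := a, y' := b)) |`| \<Delta> = \<Delta>"
      using fset.map_cong0[of \<Delta> "psubst (Var(x' := a, y' := b))" id] idle by (simp add: fset.map_id0)
    ultimately show ?thesis by (simp add: fimage_funion)
  qed
  show ?thesis
    using by_rule[OF rule_instance.intros(14)[of x' y' s t ?\<Gamma>' "psubst ?\<rho> \<delta>"]] assms(2) y'
    unfolding img ren[OF sub\<delta>] by (auto simp: HA_rules_def simp del: fun_upd_apply)
qed

text \<open>\<open>EqL\<close> exchanges \<open>s\<close> and \<open>t\<close> at marked places. A
  mark \<open>x\<close> that occurs nowhere leaves only the places marked by \<open>y\<close>, so
  the exchange becomes a one-way replacement.\<close>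

lemma eqL:
  assumes "((\<lambda>\<phi>. \<phi>\<langle>t/y\<rangle>) |`| \<Gamma>) |\<union>| \<Delta> \<tturnstile> \<delta>\<langle>t/y\<rangle>"
  shows "finsert (Eq s t) (((\<lambda>\<phi>. \<phi>\<langle>s/y\<rangle>) |`| \<Gamma>) |\<union>| \<Delta>) \<tturnstile> \<delta>\<langle>s/y\<rangle>"
proof -
  obtain x where x: "x \<notin> insert y (fvs \<Gamma> \<union> fv \<delta>)"
    using fresh_var[of "insert y (fvs \<Gamma> \<union> fv \<delta>)"] by (auto simp: finite_fv finite_fvs)
  have *: "psubst (Var(x := a, y := b)) \<phi> = \<phi>\<langle>b/y\<rangle>" if "\<phi> |\<in>| \<Gamma> \<or> \<phi> = \<delta>" for \<phi> a b
    by (rule psubst_cong) (use x that in \<open>auto simp: fvs_def\<close>)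
  have **: "psubst (Var(x := a, y := b)) |`| \<Gamma> = (\<lambda>\<phi>. \<phi>\<langle>b/y\<rangle>) |`| \<Gamma>" for a b
    by (rule fset.map_cong0) (simp add: *)
  show ?thesis using eqL2[of x y s t \<Gamma> \<Delta> \<delta>] assms x by (simp add: * **)
qed

lemma eq_subst': "\<Gamma> \<tturnstile> Eq s t \<Longrightarrow> \<Gamma> \<tturnstile> \<phi>\<langle>t/y\<rangle> \<Longrightarrow> \<Gamma> \<tturnstile> \<phi>\<langle>s/y\<rangle>"
  using eqL[where \<Gamma>="{||}" and \<Delta>=\<Gamma> and \<delta>=\<phi> and s=s and t=t and y=y] by (auto intro: cut)

lemma eq_sym: 
  assumes "\<Gamma> \<tturnstile> Eq s t" shows "\<Gamma> \<tturnstile> Eq t s"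
proof -
  obtain y where y: "y \<notin> fv_tm t" using fresh_var finite_fv_tm by blast
  show ?thesis
    using eq_subst'[OF assms, where \<phi>="Eq t (Var y)" and y=y] y by (simp add: psubst_tm_idle EqI)
qed

lemma eq_subst: "\<Gamma> \<tturnstile> Eq s t \<Longrightarrow> \<Gamma> \<tturnstile> \<phi>\<langle>s/y\<rangle> \<Longrightarrow> \<Gamma> \<tturnstile> \<phi>\<langle>t/y\<rangle>"
  by (blast intro: eq_sym eq_subst')

lemma eq_trans:
  assumes "\<Gamma> \<tturnstile> Eq s t" "\<Gamma> \<tturnstile> Eq t u" shows "\<Gamma> \<tturnstile> Eq s u"
proof -
  obtain y where y: "y \<notin> fv_tm u" using fresh_var finite_fv_tm by blast
  show ?thesis
    using eq_subst'[OF assms(1), where \<phi>="Eq (Var y) u" and y=y] y assms(2) by (simp add: psubst_tm_idle)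
qed

lemma eq_cong_tm:
  assumes "\<Gamma> \<tturnstile> Eq s t"
  shows "\<Gamma> \<tturnstile> Eq (psubst_tm (Var(y := s)) u) (psubst_tm (Var(y := t)) u)"
proof -
  obtain x where x: "x \<notin> insert y (fv_tm u \<union> fv_tm s)"
    using fresh_var[of "insert y (fv_tm u \<union> fv_tm s)"] by (auto simp: finite_fv_tm)
  \<comment> \<open>The replacement must affect only the right side of \<open>Eq ?v ?u\<close>.
    Since \<open>s\<close> may contain \<open>y\<close>, the places to be replaced are marked by a
    new variable \<open>x\<close> that is absent from \<open>?v\<close>.\<close>
  let ?u = "psubst_tm (Var(y := Var x)) u" and ?v = "psubst_tm (Var(y := s)) u"
  have "psubst_tm (Var(x := a)) ?u = psubst_tm (Var(y := a)) u" for a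
    unfolding psubst_tm_comp by (rule psubst_tm_cong) (use x in auto)
  moreover have "x \<notin> fv_tm ?v" using x by (auto simp: fv_psubst_tm split: if_splits)
  ultimately show ?thesis
    using eq_subst[OF assms, where \<phi>="Eq ?v ?u" and y=x] by (simp add: psubst_tm_idle EqI)
qed

lemma eq_Succ: "\<Gamma> \<tturnstile> Eq s t \<Longrightarrow> \<Gamma> \<tturnstile> Eq (Succ s) (Succ t)"
  using eq_cong_tm[of \<Gamma> s t 0 "Succ (Var 0)"] by simp

lemma eq_Plus:
  assumes "\<Gamma> \<tturnstile> Eq s s'" "\<Gamma> \<tturnstile> Eq t t'"
  shows "\<Gamma> \<tturnstile> Eq (Plus s t) (Plus s' t')"
proof -
  obtain y where y: "y \<notin> fv_tm s' \<union> fv_tm t"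
    using fresh_var[of "fv_tm s' \<union> fv_tm t"] by (auto simp: finite_fv_tm)
  have "\<Gamma> \<tturnstile> Eq (Plus s t) (Plus s' t)"
    using eq_cong_tm[OF assms(1), of y "Plus (Var y) t"] y by (simp add: psubst_tm_idle)
  moreover have "\<Gamma> \<tturnstile> Eq (Plus s' t) (Plus s' t')"
    using eq_cong_tm[OF assms(2), of y "Plus s' (Var y)"] y by (simp add: psubst_tm_idle)
  ultimately show ?thesis by (rule eq_trans)
qed

lemma eq_Times_right:
  assumes "\<Gamma> \<tturnstile> Eq t t'"
  shows "\<Gamma> \<tturnstile> Eq (Times s t) (Times s t')"
proof -
  obtain y where y: "y \<notin> fv_tm s" using fresh_var finite_fv_tm by blast
  show ?thesis
    using eq_cong_tm[OF assms, of y "Times s (Var y)"] y by (simp add: psubst_tm_idle)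
qed

text \<open>No rule substitutes in a whole sequent. The antecedent is moved formula by formula into
  implications; once the left side is empty, \<open>x\<close> can be generalised and instantiated by
  \<open>t\<close>.\<close>

lemma prv_subst: "\<Gamma> \<tturnstile> \<delta> \<Longrightarrow> (\<lambda>\<phi>. \<phi>\<langle>t/x\<rangle>) |`| \<Gamma> \<tturnstile> \<delta>\<langle>t/x\<rangle>"
proof (induction \<Gamma> arbitrary: \<delta>)
  case empty
  then show ?case using AllE[OF AllI_same, of "{||}" \<delta> x t] by (metis fimage_fempty fvs_empty empty_iff)
next
  case (insert \<phi> \<Gamma>)
  let ?\<Gamma> = "(\<lambda>\<phi>. \<phi>\<langle>t/x\<rangle>) |`| \<Gamma>"
  have "?\<Gamma> \<tturnstile> Imp (\<phi>\<langle>t/x\<rangle>) (\<delta>\<langle>t/x\<rangle>)"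
    using insert.IH[OF ImpI[OF insert.prems]] by (simp only: psubst.simps)
  then show ?case
    unfolding fimage_finsert by (rule ImpE[OF wk ax]) (simp_all add: fsubset_finsertI)
qed

lemma multicut:
  assumes "\<And>\<phi>. \<phi> |\<in>| \<Delta> \<Longrightarrow> \<Gamma> \<tturnstile> \<phi>" "\<Delta> |\<union>| \<Gamma> \<tturnstile> \<delta>"
  shows "\<Gamma> \<tturnstile> \<delta>"
  using assms
proof (induction \<Delta>)
  case (insert \<phi> \<Delta>)
  have "\<Delta> |\<union>| \<Gamma> \<tturnstile> \<delta>"
    by (rule cut[of _ \<phi>]) (use insert.prems in \<open>auto intro: wk\<close>)
  then show ?case using insert by auto
qed auto

section \<open>Arithmetic\<close>

text \<open>The induction axiom has no side formulas: its two hypotheses are derived from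
  \<open>\<Gamma>\<close> and cut. Freshness of \<open>x\<close> allows the step to be
  quantified.\<close>

lemma Ind_rule:
  assumes "\<phi> \<in> I" "\<Gamma> \<tturnstile> \<phi>\<langle>Zero/x\<rangle>" "finsert \<phi> \<Gamma> \<tturnstile> \<phi>\<langle>Succ (Var x)/x\<rangle>" "x \<notin> fvs \<Gamma>"
  shows "\<Gamma> \<tturnstile> \<phi>\<langle>s/x\<rangle>"
proof (rule multicut)
  let ?\<Delta> = "{|\<phi>\<langle>Zero/x\<rangle>, Forall x (Imp \<phi> (\<phi>\<langle>Succ (Var x)/x\<rangle>))|}"
  show "\<Gamma> \<tturnstile> \<psi>" if "\<psi> |\<in>| ?\<Delta>" for \<psi>
    using that assms by (auto intro: AllI_same ImpI)
  have "?\<Delta> \<tturnstile> \<phi>\<langle>s/x\<rangle>"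
    by (rule derivable.infer[OF rule_instance.intros(24)]) (use assms(1) in \<open>auto simp: HA_rules_def\<close>)
  then show "?\<Delta> |\<union>| \<Gamma> \<tturnstile> \<phi>\<langle>s/x\<rangle>" by (rule wk) auto
qed

section \<open>Recursion equations and laws of addition\<close>

lemma Plus_Zero: "\<Gamma> \<tturnstile> Eq (Plus s Zero) s"
  by (rule wk[OF by_rule[OF rule_instance.intros(20)]]) (auto simp: HA_rules_def)

lemma Plus_Succ: "\<Gamma> \<tturnstile> Eq (Plus s (Succ t)) (Succ (Plus s t))"
  by (rule wk[OF by_rule[OF rule_instance.intros(21)]]) (auto simp: HA_rules_def)

lemma Times_Zero: "\<Gamma> \<tturnstile> Eq (Times s Zero) Zero"
  by (rule wk[OF by_rule[OF rule_instance.intros(22)]]) (auto simp: HA_rules_def)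

lemma Times_Succ: "\<Gamma> \<tturnstile> Eq (Times s (Succ t)) (Plus (Times s t) s)"
  by (rule wk[OF by_rule[OF rule_instance.intros(23)]]) (auto simp: HA_rules_def)

lemma Succ_inject: "\<Gamma> \<tturnstile> Eq (Succ s) (Succ t) \<Longrightarrow> \<Gamma> \<tturnstile> Eq s t"
  by (erule cut, rule wk[OF by_rule[OF rule_instance.intros(19)]]) (auto simp: HA_rules_def)

lemma Zero_not_Succ: "\<Gamma> \<tturnstile> Eq Zero (Succ t) \<Longrightarrow> \<Gamma> \<tturnstile> \<delta>"
  by (rule BotE, erule ImpE[rotated], rule wk[OF by_rule[OF rule_instance.intros(18)]])
    (auto simp: HA_rules_def)

lemma Eq_induct:
  assumes "x \<notin> fvs \<Gamma>" "\<Gamma> \<tturnstile> Eq (psubst_tm (Var(x := Zero)) l) (psubst_tm (Var(x := Zero)) r)"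
    and "finsert (Eq l r) \<Gamma> \<tturnstile> Eq (psubst_tm (Var(x := Succ (Var x))) l) (psubst_tm (Var(x := Succ (Var x))) r)"
  shows "\<Gamma> \<tturnstile> Eq (psubst_tm (Var(x := s)) l) (psubst_tm (Var(x := s)) r)"
  using Ind_rule[of "Eq l r" \<Gamma> x s] assms Delta0_subset Delta0.intros(1) by auto

text \<open>Addition recurses on its right argument, so facts about the left one need induction. It
  is done in the empty context, where the induction variable cannot clash with
  \<open>\<Gamma>\<close>, and weakened afterwards.\<close>

lemma Zero_Plus: "\<Gamma> \<tturnstile> Eq (Plus Zero t) t"
proof -
  have "{|Eq (Plus Zero (Var 0)) (Var 0)|} \<tturnstile> Eq (Plus Zero (Succ (Var 0))) (Succ (Var 0))"
    by (rule eq_trans[OF Plus_Succ eq_Succ[OF ax]]) simp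
  then have "{||} \<tturnstile> Eq (Plus Zero t) t"
    using Eq_induct[of 0 "{||}" "Plus Zero (Var 0)" "Var 0" t] Plus_Zero by simp
  then show ?thesis by (rule wk) simp
qed

lemma Succ_Plus: "\<Gamma> \<tturnstile> Eq (Plus (Succ s) t) (Succ (Plus s t))"
proof -
  obtain x where x: "x \<notin> fv_tm s" using fresh_var[OF finite_fv_tm] by blast
  let ?l = "Plus (Succ s) (Var x)" and ?r = "Succ (Plus s (Var x))"
  have "{|Eq ?l ?r|} \<tturnstile> Eq (Plus (Succ s) (Succ (Var x))) (Succ (Plus s (Succ (Var x))))"
    by (rule eq_trans[OF Plus_Succ eq_trans[OF eq_Succ[OF ax] eq_Succ[OF eq_sym[OF Plus_Succ]]]]) simp
  moreover have "{||} \<tturnstile> Eq (Plus (Succ s) Zero) (Succ (Plus s Zero))"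
    by (rule eq_trans[OF Plus_Zero eq_Succ[OF eq_sym[OF Plus_Zero]]])
  ultimately have "{||} \<tturnstile> Eq (Plus (Succ s) t) (Succ (Plus s t))"
    using Eq_induct[of x "{||}" ?l ?r t] x by (simp add: psubst_tm_idle)
  then show ?thesis by (rule wk) simp
qed

lemma Plus_commute: "\<Gamma> \<tturnstile> Eq (Plus s t) (Plus t s)"
proof -
  obtain x where x: "x \<notin> fv_tm s" using fresh_var[OF finite_fv_tm] by blast
  let ?l = "Plus s (Var x)" and ?r = "Plus (Var x) s"
  have "{|Eq ?l ?r|} \<tturnstile> Eq (Plus s (Succ (Var x))) (Plus (Succ (Var x)) s)"
    by (rule eq_trans[OF Plus_Succ eq_trans[OF eq_Succ[OF ax] eq_sym[OF Succ_Plus]]]) simp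
  moreover have "{||} \<tturnstile> Eq (Plus s Zero) (Plus Zero s)"
    by (rule eq_trans[OF Plus_Zero eq_sym[OF Zero_Plus]])
  ultimately have "{||} \<tturnstile> Eq (Plus s t) (Plus t s)"
    using Eq_induct[of x "{||}" ?l ?r t] x by (simp add: psubst_tm_idle)
  then show ?thesis by (rule wk) simp
qed

lemma Plus_assoc: "\<Gamma> \<tturnstile> Eq (Plus (Plus s t) u) (Plus s (Plus t u))"
proof -
  obtain x where x: "x \<notin> fv_tm s \<union> fv_tm t"
    using fresh_var[of "fv_tm s \<union> fv_tm t"] by (auto simp: finite_fv_tm)
  let ?l = "Plus (Plus s t) (Var x)" and ?r = "Plus s (Plus t (Var x))"
  have "{|Eq ?l ?r|} \<tturnstile> Eq (Plus (Plus s t) (Succ (Var x))) (Plus s (Plus t (Succ (Var x))))"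
    by (rule eq_trans[OF Plus_Succ eq_trans[OF eq_Succ[OF ax]
        eq_sym[OF eq_trans[OF eq_Plus[OF EqI Plus_Succ] Plus_Succ]]]]) simp
  moreover have "{||} \<tturnstile> Eq (Plus (Plus s t) Zero) (Plus s (Plus t Zero))"
    by (rule eq_trans[OF Plus_Zero eq_Plus[OF EqI eq_sym[OF Plus_Zero]]])
  ultimately have "{||} \<tturnstile> Eq (Plus (Plus s t) u) (Plus s (Plus t u))"
    using Eq_induct[of x "{||}" ?l ?r u] x by (simp add: psubst_tm_idle)
  then show ?thesis by (rule wk) simp
qed

section \<open>Bounded quantifiers and the order\<close>

lemma ForallLessI: "finsert (less_fm (Var x) t) \<Gamma> \<tturnstile> \<phi> \<Longrightarrow> x \<notin> fvs \<Gamma> \<Longrightarrow> \<Gamma> \<tturnstile> ForallLess x t \<phi>"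
  unfolding ForallLess_def by (intro AllI_same ImpI)

lemma ForallLessE:
  "\<Gamma> \<tturnstile> ForallLess x t \<phi> \<Longrightarrow> x \<notin> fv_tm t \<Longrightarrow> \<Gamma> \<tturnstile> less_fm u t \<Longrightarrow> \<Gamma> \<tturnstile> \<phi>\<langle>u/x\<rangle>"
  unfolding ForallLess_def using AllE[of \<Gamma> x "Imp (less_fm (Var x) t) \<phi>" u]
  by (auto simp: psubst_less psubst_tm_idle intro: ImpE)

lemma ExistsLessI:
  "\<Gamma> \<tturnstile> less_fm u t \<Longrightarrow> \<Gamma> \<tturnstile> \<phi>\<langle>u/x\<rangle> \<Longrightarrow> x \<notin> fv_tm t \<Longrightarrow> \<Gamma> \<tturnstile> ExistsLess x t \<phi>"
  unfolding ExistsLess_def by (rule ExI[of _ _ u]) (simp add: psubst_less psubst_tm_idle AndI)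

lemma ExistsLessE:
  assumes "\<Gamma> \<tturnstile> ExistsLess x t \<phi>" "x \<notin> fv_tm t" "finite A"
    and "\<And>y. y \<notin> A \<union> fvs \<Gamma> \<union> fv \<delta> \<Longrightarrow> finsert (less_fm (Var y) t) (finsert (\<phi>\<langle>Var y/x\<rangle>) \<Gamma>) \<tturnstile> \<delta>"
  shows "\<Gamma> \<tturnstile> \<delta>"
  by (rule ExE[OF assms(1)[unfolded ExistsLess_def] assms(3)])
    (use assms(2,4) in \<open>simp add: psubst_less psubst_tm_idle AndL\<close>)

lemma lessI:
  assumes "\<Gamma> \<tturnstile> Eq t (Plus s (Succ u))"
  shows "\<Gamma> \<tturnstile> less_fm s t"
proof -
  obtain z where z: "z \<notin> fv_tm s \<union> fv_tm t"
    using fresh_var[of "fv_tm s \<union> fv_tm t"] by (auto simp: finite_fv_tm)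
  then show ?thesis
    using assms by (subst less_eq_Exists[of z]) (auto intro!: ExI[of _ _ u] simp: psubst_tm_idle)
qed

lemma lessE:
  assumes "\<Gamma> \<tturnstile> less_fm s t"
    and "\<And>y. y \<notin> fv_tm s \<union> fv_tm t \<union> fvs \<Gamma> \<union> fv \<delta> \<Longrightarrow> finsert (Eq t (Plus s (Succ (Var y)))) \<Gamma> \<tturnstile> \<delta>"
  shows "\<Gamma> \<tturnstile> \<delta>"
proof -
  obtain z where z: "z \<notin> fv_tm s \<union> fv_tm t"
    using fresh_var[of "fv_tm s \<union> fv_tm t"] by (auto simp: finite_fv_tm)
  have "\<Gamma> \<tturnstile> Exists z (Eq t (Plus s (Succ (Var z))))"
    using assms(1) z by (metis UnCI less_eq_Exists)
  then show ?thesis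
    by (rule ExE[of _ _ _ "fv_tm s \<union> fv_tm t"])
      (use assms(2) z in \<open>auto simp: finite_fv_tm psubst_tm_idle\<close>)
qed

lemma not_less_Zero: "\<Gamma> \<tturnstile> less_fm s Zero \<Longrightarrow> \<Gamma> \<tturnstile> \<delta>"
  by (erule lessE, rule Zero_not_Succ, rule eq_trans[OF ax Plus_Succ], rule finsertI1)

lemma less_Succ_self: "\<Gamma> \<tturnstile> less_fm t (Succ t)"
  by (rule lessI[of _ _ _ Zero], rule eq_sym, rule eq_trans[OF Plus_Succ eq_Succ[OF Plus_Zero]])

lemma less_trans:
  assumes "\<Gamma> \<tturnstile> less_fm s t" "\<Gamma> \<tturnstile> less_fm t u"
  shows "\<Gamma> \<tturnstile> less_fm s u"
proof (rule lessE[OF assms(1)])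
  fix y
  let ?\<Gamma> = "finsert (Eq t (Plus s (Succ (Var y)))) \<Gamma>"
  show "?\<Gamma> \<tturnstile> less_fm s u"
  proof (rule lessE)
    show "?\<Gamma> \<tturnstile> less_fm t u" using assms(2) by (rule wk) auto
    fix z
    show "finsert (Eq u (Plus t (Succ (Var z)))) ?\<Gamma> \<tturnstile> less_fm s u" (is "?\<Gamma>' \<tturnstile> _")
      by (rule lessI[of _ _ _ "Plus (Succ (Var y)) (Var z)"],
          rule eq_trans[OF ax eq_trans[OF eq_Plus[OF ax EqI] eq_trans[OF Plus_assoc eq_Plus[OF EqI Plus_Succ]]]])
        auto
  qed
qed

lemma less_eq_right: "\<Gamma> \<tturnstile> less_fm s t \<Longrightarrow> \<Gamma> \<tturnstile> Eq t' t \<Longrightarrow> \<Gamma> \<tturnstile> less_fm s t'"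
  by (erule lessE) (rule lessI, rule eq_trans[OF wk ax], auto)

lemma Succ_less_Succ: "\<Gamma> \<tturnstile> less_fm (Succ s) (Succ t) \<Longrightarrow> \<Gamma> \<tturnstile> less_fm s t"
  by (erule lessE) (rule lessI, rule Succ_inject, rule eq_trans[OF ax Succ_Plus], auto)

lemma less_Plus_right:
  assumes "\<Gamma> \<tturnstile> less_fm s t"
  shows "\<Gamma> \<tturnstile> less_fm s (Plus t u)"
proof (rule lessE[OF assms])
  fix y
  show "finsert (Eq t (Plus s (Succ (Var y)))) \<Gamma> \<tturnstile> less_fm s (Plus t u)"
    by (rule lessI[of _ _ _ "Plus (Var y) u"],
        rule eq_trans[OF eq_Plus[OF ax EqI] eq_trans[OF Plus_assoc eq_Plus[OF EqI Succ_Plus]]]) auto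
qed

lemma less_Plus_left: "\<Gamma> \<tturnstile> less_fm s t \<Longrightarrow> \<Gamma> \<tturnstile> less_fm s (Plus u t)"
  by (rule less_eq_right[OF less_Plus_right Plus_commute])

text \<open>An unbounded predecessor quantifier would leave \<open>Delta0\<close>, so the
  predecessor is bounded by the number itself. In the induction step it is the induction
  variable.\<close>

lemma nat_cases:
  assumes "finsert (Eq t Zero) \<Gamma> \<tturnstile> \<delta>" "finite A"
    and "\<And>w. w \<notin> A \<union> fv_tm t \<union> fvs \<Gamma> \<union> fv \<delta> \<Longrightarrow> finsert (Eq t (Succ (Var w))) \<Gamma> \<tturnstile> \<delta>"
  shows "\<Gamma> \<tturnstile> \<delta>"
proof -
  obtain w where w: "w \<notin> insert 0 (fv_tm t)"
    using fresh_var[of "insert 0 (fv_tm t)"] by (auto simp: finite_fv_tm)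
  let ?\<phi> = "Or (Eq (Var 0) Zero) (ExistsLess w (Var 0) (Eq (Var 0) (Succ (Var w))))"
  have D: "?\<phi> \<in> I" using Delta0_subset w by (auto intro!: Delta0.intros)
  have "{||} \<tturnstile> ?\<phi>\<langle>t/0\<rangle>"
  proof (rule Ind_rule[OF D])
    show "{||} \<tturnstile> ?\<phi>\<langle>Zero/0\<rangle>" by (auto intro: OrI1 EqI)
    have "{|?\<phi>|} \<tturnstile> ExistsLess w (Succ (Var 0)) (Eq (Succ (Var 0)) (Succ (Var w)))"
      using w by (intro ExistsLessI[of _ "Var 0"]) (auto intro: less_Succ_self EqI)
    then show "{|?\<phi>|} \<tturnstile> ?\<phi>\<langle>Succ (Var 0)/0\<rangle>"
      using w by (auto intro: OrI2 simp: subst_ExistsLess)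
  qed simp
  then have "\<Gamma> \<tturnstile> Or (Eq t Zero) (ExistsLess w t (Eq t (Succ (Var w))))"
    using w by (auto simp: subst_ExistsLess intro: wk)
  then show ?thesis
  proof (rule OrE)
    let ?\<Gamma> = "finsert (ExistsLess w t (Eq t (Succ (Var w)))) \<Gamma>"
    show "?\<Gamma> \<tturnstile> \<delta>"
    proof (rule ExistsLessE)
      show "?\<Gamma> \<tturnstile> ExistsLess w t (Eq t (Succ (Var w)))" by (rule ax) simp
      show "finite (A \<union> fv_tm t)" using assms(2) finite_fv_tm by simp
      fix y assume "y \<notin> A \<union> fv_tm t \<union> fvs ?\<Gamma> \<union> fv \<delta>"
      then have "finsert (Eq t (Succ (Var y))) \<Gamma> \<tturnstile> \<delta>" by (intro assms(3)) auto
      then show "finsert (less_fm (Var y) t) (finsert (Eq t (Succ (Var w)))\<langle>Var y/w\<rangle> ?\<Gamma>) \<tturnstile> \<delta>"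
        using w by (auto simp: psubst_tm_idle elim!: wk)
    qed (use w in auto)
  qed (rule assms(1))
qed

text \<open>Comparability is first proved for the weak order, \<open>b = a + w\<close> for some
  \<open>w\<close>, by induction on the term compared with \<open>t\<close>. Asking whether the
  difference is zero or a successor then turns a weak comparison into an equality or a strict
  one.\<close>

lemma trichotomy:
  assumes "finsert (less_fm s t) \<Gamma> \<tturnstile> \<delta>" "finsert (Eq s t) \<Gamma> \<tturnstile> \<delta>" "finsert (less_fm t s) \<Gamma> \<tturnstile> \<delta>"
  shows "\<Gamma> \<tturnstile> \<delta>"
proof -
  obtain x where x: "x \<notin> fv_tm s \<union> fv_tm t"
    using fresh_var[of "fv_tm s \<union> fv_tm t"] by (auto simp: finite_fv_tm)
  obtain w where w: "w \<notin> insert x (fv_tm s \<union> fv_tm t)"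
    using fresh_var[of "insert x (fv_tm s \<union> fv_tm t)"] by (auto simp: finite_fv_tm)
  \<comment> \<open>The witness is bounded so that the induction formula below is \<open>\<Delta>\<^sub>0\<close>.\<close>
  define le where "le a b = ExistsLess w (Succ b) (Eq b (Plus a (Var w)))" for a b
  have leI: "\<Gamma> \<tturnstile> le a b" if "\<Gamma> \<tturnstile> Eq b (Plus a u)" "w \<notin> fv_tm a \<union> fv_tm b" for \<Gamma> a b u
    unfolding le_def
  proof (rule ExistsLessI[of _ u])
    \<comment> \<open>From \<open>b = a + u\<close> follows \<open>Sb = u + Sa\<close>, so
      \<open>a\<close> witnesses that \<open>u\<close> respects the bound.\<close>
    show "\<Gamma> \<tturnstile> less_fm u (Succ b)"
      by (rule lessI[of _ _ _ a])
        (rule eq_trans[OF eq_Succ[OF eq_trans[OF that(1) Plus_commute]] eq_sym[OF Plus_Succ]])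
  qed (use that in \<open>auto simp: psubst_tm_idle\<close>)
  have leE: "\<Gamma> \<tturnstile> \<delta>"
    if "\<Gamma> \<tturnstile> le a b" "w \<notin> fv_tm a \<union> fv_tm b" "\<And>y. finsert (Eq b (Plus a (Var y))) \<Gamma> \<tturnstile> \<delta>" for \<Gamma> a b \<delta>
    by (rule ExistsLessE[OF that(1)[unfolded le_def], of "{}"])
      (use that(2,3) in \<open>auto simp: psubst_tm_idle intro: wk\<close>)
  let ?\<phi> = "Or (le (Var x) t) (le t (Var x))"
  have D: "?\<phi> \<in> I" using Delta0_subset w by (auto intro!: Delta0.intros simp: le_def)
  have sub: "(le a b)\<langle>u/x\<rangle> = le (psubst_tm (Var(x := u)) a) (psubst_tm (Var(x := u)) b)"
    if "w \<notin> fv_tm u" for a b u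
    using w that by (simp add: le_def subst_ExistsLess)
  have "{||} \<tturnstile> ?\<phi>\<langle>s/x\<rangle>"
  proof (rule Ind_rule[OF D])
    have "{||} \<tturnstile> le Zero t" by (rule leI[OF eq_sym[OF Zero_Plus]]) (use w in auto)
    then show "{||} \<tturnstile> ?\<phi>\<langle>Zero/x\<rangle>" using x by (simp add: sub psubst_tm_idle OrI1)
    have "{|?\<phi>|} \<tturnstile> Or (le (Succ (Var x)) t) (le t (Succ (Var x)))"
    proof (rule OrL)
      show "{|le (Var x) t|} \<tturnstile> Or (le (Succ (Var x)) t) (le t (Succ (Var x)))"
      proof (rule leE[OF ax])
        fix y
        show "{|Eq t (Plus (Var x) (Var y)), le (Var x) t|} \<tturnstile> Or (le (Succ (Var x)) t) (le t (Succ (Var x)))"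
        \<comment> \<open>For \<open>t = x + y\<close>: if \<open>y = 0\<close> the comparison turns
          over, as \<open>Sx = t + S0\<close>; if \<open>y = Sv\<close> then
          \<open>t = Sx + v\<close> and it keeps its direction.\<close>
        proof (rule nat_cases[of "Var y" _ _ "{}"])
          let ?\<Gamma> = "{|Eq (Var y) Zero, Eq t (Plus (Var x) (Var y)), le (Var x) t|}"
          have "?\<Gamma> \<tturnstile> Eq t (Var x)"
            by (rule eq_trans[OF ax eq_trans[OF eq_Plus[OF EqI ax] Plus_Zero]]) auto
          then have "?\<Gamma> \<tturnstile> Eq (Succ (Var x)) (Plus t (Succ Zero))"
            by (intro eq_sym[OF eq_trans[OF Plus_Succ eq_Succ[OF eq_trans[OF Plus_Zero]]]])
          then show "?\<Gamma> \<tturnstile> Or (le (Succ (Var x)) t) (le t (Succ (Var x)))"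
            by (rule OrI2[OF leI]) (use w in auto)
          fix v
          let ?\<Gamma> = "{|Eq (Var y) (Succ (Var v)), Eq t (Plus (Var x) (Var y)), le (Var x) t|}"
          have "?\<Gamma> \<tturnstile> Eq t (Plus (Succ (Var x)) (Var v))"
            by (rule eq_trans[OF ax eq_trans[OF eq_Plus[OF EqI ax] eq_trans[OF Plus_Succ eq_sym[OF Succ_Plus]]]]) auto
          then show "?\<Gamma> \<tturnstile> Or (le (Succ (Var x)) t) (le t (Succ (Var x)))"
            by (rule OrI1[OF leI]) (use w in auto)
        qed simp
      qed (use w in auto)
      show "{|le t (Var x)|} \<tturnstile> Or (le (Succ (Var x)) t) (le t (Succ (Var x)))"
      proof (rule leE[OF ax])
        fix y
        have "{|Eq (Var x) (Plus t (Var y)), le t (Var x)|} \<tturnstile> Eq (Succ (Var x)) (Plus t (Succ (Var y)))"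
          by (rule eq_trans[OF eq_Succ[OF ax] eq_sym[OF Plus_Succ]]) auto
        then show "{|Eq (Var x) (Plus t (Var y)), le t (Var x)|} \<tturnstile> Or (le (Succ (Var x)) t) (le t (Succ (Var x)))"
          by (rule OrI2[OF leI]) (use w in auto)
      qed (use w in auto)
    qed
    then show "{|?\<phi>|} \<tturnstile> ?\<phi>\<langle>Succ (Var x)/x\<rangle>"
      using w x by (simp add: sub psubst_tm_idle)
  qed simp
  then have "\<Gamma> \<tturnstile> Or (le s t) (le t s)"
    using x w by (auto simp: sub psubst_tm_idle intro: wk)
  moreover have le_cases: "finsert (le a b) \<Gamma> \<tturnstile> \<delta>"
    if w: "w \<notin> fv_tm a \<union> fv_tm b" and less: "finsert (less_fm a b) \<Gamma> \<tturnstile> \<delta>" and eq: "finsert (Eq a b) \<Gamma> \<tturnstile> \<delta>" for a b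
  proof (rule leE[OF ax _])
    fix y
    show "finsert (Eq b (Plus a (Var y))) (finsert (le a b) \<Gamma>) \<tturnstile> \<delta>" (is "?\<Gamma> \<tturnstile> _")
    proof (rule nat_cases[of "Var y" _ _ "{}"])
      have "finsert (Eq (Var y) Zero) ?\<Gamma> \<tturnstile> Eq a b"
        by (rule eq_sym, rule eq_trans[OF ax eq_trans[OF eq_Plus[OF EqI ax] Plus_Zero]]) auto
      then show "finsert (Eq (Var y) Zero) ?\<Gamma> \<tturnstile> \<delta>"
        by (rule cut) (rule wk[OF eq], auto)
      fix v
      have "finsert (Eq (Var y) (Succ (Var v))) ?\<Gamma> \<tturnstile> less_fm a b"
        by (rule lessI, rule eq_trans[OF ax eq_Plus[OF EqI ax]]) auto
      then show "finsert (Eq (Var y) (Succ (Var v))) ?\<Gamma> \<tturnstile> \<delta>"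
        by (rule cut) (rule wk[OF less], auto)
    qed simp
  qed (use w in auto)
  moreover have "finsert (Eq t s) \<Gamma> \<tturnstile> \<delta>"
    by (rule cut[OF eq_sym[OF ax[OF finsertI1]]]) (rule wk[OF assms(2)], auto)
  ultimately show ?thesis
    using w assms by (elim OrE) auto
qed

end

section \<open>Bounded and simultaneous induction\<close>

text \<open>The variables \<open>p\<close> and \<open>q\<close> are switches with values 0 and 1. A
  number \<open>r < p + q\<close> exists only if one of them is on, and then
  \<open>s * p + t * q\<close> is at least \<open>s\<close> or at least \<open>t\<close>. Only
  bounded quantifiers are put in front of \<open>\<phi>\<close>, because \<open>Pi_closure\<close>
  is not closed under disjunction.\<close>

definition either :: "var \<Rightarrow> var \<Rightarrow> var \<Rightarrow> var \<Rightarrow> tm \<Rightarrow> tm \<Rightarrow> fm \<Rightarrow> fm" where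
  "either p q r x s t \<phi> = ExistsLess p (Succ (Succ Zero)) (ExistsLess q (Succ (Succ Zero))
    (ExistsLess r (Plus (Var p) (Var q))
      (ForallLess x (Plus (Times s (Var p)) (Times t (Var q))) \<phi>)))"

definition either_fresh :: "var \<Rightarrow> var \<Rightarrow> var \<Rightarrow> var \<Rightarrow> tm \<Rightarrow> tm \<Rightarrow> fm \<Rightarrow> bool" where
  "either_fresh p q r x s t \<phi> \<longleftrightarrow> distinct [p, q, r, x] \<and>
    {p, q, r} \<inter> (fv_tm s \<union> fv_tm t \<union> fv \<phi>) = {} \<and> x \<notin> fv_tm s \<union> fv_tm t"

lemma either_Pi_closure:
  assumes "either_fresh p q r x s t \<phi>" "\<phi> \<in> Pi_closure \<Theta>"
  shows "either p q r x s t \<phi> \<in> Pi_closure \<Theta>"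
  using assms by (auto simp: either_def either_fresh_def intro!: Pi_closure.intros(2,3))

lemma subst_either:
  assumes "z \<notin> {p, q, r, x} \<union> fv_tm t \<union> fv \<phi>" "{p, q, r, x} \<inter> fv_tm u = {}"
  shows "(either p q r x s t \<phi>)\<langle>u/z\<rangle> = either p q r x (psubst_tm (Var(z := u)) s) t \<phi>"
  using assms by (simp add: either_def subst_ExistsLess subst_ForallLess psubst_idle psubst_tm_idle)

context restricted_HA
begin

section \<open>Introduction and elimination rules for \<open>either\<close>\<close>

lemma ForallLess_mono:
  assumes "\<Gamma> \<tturnstile> ForallLess x t \<phi>" "x \<notin> fv_tm s \<union> fv_tm t"
    and "\<And>y. finsert (less_fm (Var y) s) \<Gamma> \<tturnstile> less_fm (Var y) t"
  shows "\<Gamma> \<tturnstile> ForallLess x s \<phi>"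
proof -
  let ?\<psi> = "Imp (less_fm (Var x) s) \<phi>"
  obtain y where y: "y \<notin> fvs \<Gamma> \<union> fv (Forall x ?\<psi>)"
    using fresh_var[of "fvs \<Gamma> \<union> fv (Forall x ?\<psi>)"] finite_fvs finite_fv by blast
  have "finsert (less_fm (Var y) s) \<Gamma> \<tturnstile> \<phi>\<langle>Var y/x\<rangle>"
    by (rule ForallLessE[OF wk[OF assms(1)] _ assms(3)]) (use assms(2) in auto)
  then have "\<Gamma> \<tturnstile> ?\<psi>\<langle>Var y/x\<rangle>"
    using assms(2) by (simp add: psubst_less psubst_tm_idle ImpI)
  then show ?thesis
    unfolding ForallLess_def by (rule AllI) (use y in auto)
qed

text \<open>The switches are set to closed terms, so that substituting them under the inner
  quantifiers is harmless; \<open>r\<close> is witnessed by \<open>Zero\<close>.\<close>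

lemma eitherI:
  assumes fresh: "either_fresh p q r x s t \<phi>"
    and \<phi>: "\<Gamma> \<tturnstile> ForallLess x (Plus (Times s P) (Times t Q)) \<phi>"
    and closed: "fv_tm P = {}" "fv_tm Q = {}"
    and less: "\<Gamma> \<tturnstile> less_fm P (Succ (Succ Zero))" "\<Gamma> \<tturnstile> less_fm Q (Succ (Succ Zero))"
      "\<Gamma> \<tturnstile> less_fm Zero (Plus P Q)"
  shows "\<Gamma> \<tturnstile> either p q r x s t \<phi>"
  unfolding either_def
  by (intro ExistsLessI[OF less(1)] ExistsLessI[OF less(2)] ExistsLessI[OF less(3)],
      use fresh \<phi> closed in \<open>simp_all add: either_fresh_def subst_ExistsLess subst_ForallLess psubst_idle psubst_tm_idle
        ExistsLessI[OF less(2)] ExistsLessI[OF less(3)]\<close>)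

lemma eitherI1:
  assumes fresh: "either_fresh p q r x s t \<phi>" and \<phi>: "\<Gamma> \<tturnstile> ForallLess x s \<phi>"
  shows "\<Gamma> \<tturnstile> either p q r x s t \<phi>"
proof (rule eitherI[OF fresh, of _ "Succ Zero" Zero])
  have "\<Gamma> \<tturnstile> Eq (Plus (Times s (Succ Zero)) (Times t Zero)) s" for \<Gamma>
    by (rule eq_trans[OF eq_Plus[OF eq_trans[OF Times_Succ eq_trans[OF eq_Plus[OF Times_Zero EqI] Zero_Plus]] Times_Zero] Plus_Zero])
  then show "\<Gamma> \<tturnstile> ForallLess x (Plus (Times s (Succ Zero)) (Times t Zero)) \<phi>"
    using fresh by (intro ForallLess_mono[OF \<phi>] less_eq_right[OF ax eq_sym]) (auto simp: either_fresh_def)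
  show "\<Gamma> \<tturnstile> less_fm Zero (Plus (Succ Zero) Zero)"
    by (rule less_Plus_right[OF less_Succ_self])
  show "\<Gamma> \<tturnstile> less_fm Zero (Succ (Succ Zero))"
    by (rule less_trans[OF less_Succ_self less_Succ_self])
qed (simp_all add: less_Succ_self)

lemma eitherI2:
  assumes fresh: "either_fresh p q r x s t \<phi>" and \<phi>: "\<Gamma> \<tturnstile> ForallLess x t \<phi>"
  shows "\<Gamma> \<tturnstile> either p q r x s t \<phi>"
proof (rule eitherI[OF fresh, of _ Zero "Succ Zero"])
  have "\<Gamma> \<tturnstile> Eq (Plus (Times s Zero) (Times t (Succ Zero))) t" for \<Gamma>
    by (rule eq_trans[OF eq_Plus[OF Times_Zero eq_trans[OF Times_Succ eq_trans[OF eq_Plus[OF Times_Zero EqI] Zero_Plus]]] Zero_Plus])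
  then show "\<Gamma> \<tturnstile> ForallLess x (Plus (Times s Zero) (Times t (Succ Zero))) \<phi>"
    using fresh by (intro ForallLess_mono[OF \<phi>] less_eq_right[OF ax eq_sym]) (auto simp: either_fresh_def)
  show "\<Gamma> \<tturnstile> less_fm Zero (Plus Zero (Succ Zero))"
    by (rule less_Plus_left[OF less_Succ_self])
  show "\<Gamma> \<tturnstile> less_fm Zero (Succ (Succ Zero))"
    by (rule less_trans[OF less_Succ_self less_Succ_self])
qed (simp_all add: less_Succ_self)

text \<open>Each switch is split into zero and successor. Both being zero contradicts the existence
  of a number below their sum; a successor makes the common bound at least \<open>s\<close> or at
  least \<open>t\<close>, and the universal statement is restricted accordingly.\<close>

lemma eitherE:
  assumes fresh: "either_fresh p q r x s t \<phi>" and either: "\<Gamma> \<tturnstile> either p q r x s t \<phi>"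
    and s: "finsert (ForallLess x s \<phi>) \<Gamma> \<tturnstile> \<delta>" and t: "finsert (ForallLess x t \<phi>) \<Gamma> \<tturnstile> \<delta>"
  shows "\<Gamma> \<tturnstile> \<delta>"
proof (rule ExistsLessE[OF either[unfolded either_def], of "{p, q, r, x} \<union> fv_tm s \<union> fv_tm t \<union> fv \<phi>"])
  fix p'
  let ?A = "{p, q, r, x} \<union> fv_tm s \<union> fv_tm t \<union> fv \<phi>"
  let ?\<phi>1 = "ExistsLess q (Succ (Succ Zero)) (ExistsLess r (Plus (Var p) (Var q))
      (ForallLess x (Plus (Times s (Var p)) (Times t (Var q))) \<phi>))"
  let ?\<Gamma>1 = "finsert (less_fm (Var p') (Succ (Succ Zero))) (finsert (?\<phi>1\<langle>Var p'/p\<rangle>) \<Gamma>)"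
  assume p': "p' \<notin> ?A \<union> fvs \<Gamma> \<union> fv \<delta>"
  let ?\<phi>2 = "ExistsLess r (Plus (Var p') (Var q)) (ForallLess x (Plus (Times s (Var p')) (Times t (Var q))) \<phi>)"
  have 1: "?\<phi>1\<langle>Var p'/p\<rangle> = ExistsLess q (Succ (Succ Zero)) ?\<phi>2"
    using fresh p'
    by (auto simp: either_fresh_def subst_ExistsLess subst_ForallLess psubst_idle psubst_tm_idle)
  show "?\<Gamma>1 \<tturnstile> \<delta>"
  proof (rule ExistsLessE)
    show "?\<Gamma>1 \<tturnstile> ExistsLess q (Succ (Succ Zero)) ?\<phi>2"
      by (rule ax) (simp add: 1)
    show "finite (insert p' ?A)" by (simp add: finite_fv finite_fv_tm)
    fix q' assume q': "q' \<notin> insert p' ?A \<union> fvs ?\<Gamma>1 \<union> fv \<delta>"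
    let ?\<Gamma>2 = "finsert (less_fm (Var q') (Succ (Succ Zero))) (finsert (?\<phi>2\<langle>Var q'/q\<rangle>) ?\<Gamma>1)"
    let ?\<phi>3 = "ForallLess x (Plus (Times s (Var p')) (Times t (Var q'))) \<phi>"
    have 2: "?\<phi>2\<langle>Var q'/q\<rangle> = ExistsLess r (Plus (Var p') (Var q')) ?\<phi>3"
      using fresh p' q'
      by (auto simp: either_fresh_def subst_ExistsLess subst_ForallLess psubst_idle psubst_tm_idle)
    show "?\<Gamma>2 \<tturnstile> \<delta>"
    proof (rule ExistsLessE)
      show "?\<Gamma>2 \<tturnstile> ExistsLess r (Plus (Var p') (Var q')) ?\<phi>3"
        by (rule ax) (simp add: 2)
      show "finite (insert q' (insert p' ?A))" by (simp add: finite_fv finite_fv_tm)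
      fix r' assume r': "r' \<notin> insert q' (insert p' ?A) \<union> fvs ?\<Gamma>2 \<union> fv \<delta>"
      let ?\<Gamma>3 = "finsert (less_fm (Var r') (Plus (Var p') (Var q'))) (finsert (?\<phi>3\<langle>Var r'/r\<rangle>) ?\<Gamma>2)"
      have 3: "?\<phi>3\<langle>Var r'/r\<rangle> = ?\<phi>3"
        using fresh p' q' r' by (intro psubst_idle) (auto simp: either_fresh_def fv_ForallLess)
      have mono: "\<Gamma>' \<tturnstile> ForallLess x u \<phi>"
        if "?\<Gamma>3 |\<subseteq>| \<Gamma>'" "x \<notin> fv_tm u"
          "\<And>y. finsert (less_fm (Var y) u) \<Gamma>' \<tturnstile> less_fm (Var y) (Plus (Times s (Var p')) (Times t (Var q')))"
        for \<Gamma>' u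
        by (rule ForallLess_mono[OF wk[OF ax[of ?\<phi>3]]])
          (use that fresh p' q' 3 in \<open>auto simp: either_fresh_def\<close>)
      show "?\<Gamma>3 \<tturnstile> \<delta>"
      proof (rule nat_cases[of "Var p'" _ _ "{}"])
        let ?\<Gamma>4 = "finsert (Eq (Var p') Zero) ?\<Gamma>3"
        show "?\<Gamma>4 \<tturnstile> \<delta>"
        proof (rule nat_cases[of "Var q'" _ _ "{}"])
          let ?\<Gamma>5 = "finsert (Eq (Var q') Zero) ?\<Gamma>4"
          have "?\<Gamma>5 \<tturnstile> Eq Zero (Plus (Var p') (Var q'))"
            by (rule eq_sym, rule eq_trans[OF eq_Plus[OF ax ax] Plus_Zero]) auto
          then have "?\<Gamma>5 \<tturnstile> less_fm (Var r') Zero"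
            by (rule less_eq_right[rotated]) (rule ax, simp)
          then show "?\<Gamma>5 \<tturnstile> \<delta>" by (rule not_less_Zero)
          fix v
          let ?\<Gamma>5 = "finsert (Eq (Var q') (Succ (Var v))) ?\<Gamma>4"
          have eq: "?\<Gamma>5 \<tturnstile> Eq (Times t (Var q')) (Plus (Times t (Var v)) t)"
            by (rule eq_trans[OF eq_Times_right[OF ax] Times_Succ]) simp
          have "?\<Gamma>5 \<tturnstile> ForallLess x t \<phi>"
          proof (rule mono)
            fix y
            show "finsert (less_fm (Var y) t) ?\<Gamma>5 \<tturnstile> less_fm (Var y) (Plus (Times s (Var p')) (Times t (Var q')))"
              by (rule less_Plus_left, rule less_eq_right[OF less_Plus_left[OF ax] wk[OF eq]]) auto
          qed (use fresh in \<open>auto simp: either_fresh_def\<close>)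
          then show "?\<Gamma>5 \<tturnstile> \<delta>"
            by (rule cut) (rule wk[OF t], auto)
        qed simp
        fix v
        let ?\<Gamma>4 = "finsert (Eq (Var p') (Succ (Var v))) ?\<Gamma>3"
        have eq: "?\<Gamma>4 \<tturnstile> Eq (Times s (Var p')) (Plus (Times s (Var v)) s)"
          by (rule eq_trans[OF eq_Times_right[OF ax] Times_Succ]) simp
        have "?\<Gamma>4 \<tturnstile> ForallLess x s \<phi>"
        proof (rule mono)
          fix y
          show "finsert (less_fm (Var y) s) ?\<Gamma>4 \<tturnstile> less_fm (Var y) (Plus (Times s (Var p')) (Times t (Var q')))"
            by (rule less_Plus_right, rule less_eq_right[OF less_Plus_left[OF ax] wk[OF eq]]) auto
        qed (use fresh in \<open>auto simp: either_fresh_def\<close>)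
        then show "?\<Gamma>4 \<tturnstile> \<delta>"
          by (rule cut) (rule wk[OF s], auto)
      qed simp
    qed (use fresh p' q' in \<open>auto simp: either_fresh_def\<close>)
  qed (use fresh p' in \<open>auto simp: either_fresh_def\<close>)
qed (simp_all add: finite_fv finite_fv_tm)

text \<open>The step is available only for \<open>z < t\<close>, so the induction formula says that
  the claim holds up to \<open>z\<close> or up to \<open>t\<close>. If \<open>z\<close> is not below
  \<open>t\<close>, the claim up to \<open>z\<close> includes the claim up to \<open>t\<close>, and
  the second alternative persists from there on. Instantiating \<open>z\<close> by \<open>t\<close>
  makes both alternatives coincide.\<close>

lemma bounded_induction:
  assumes "x \<notin> fvs \<Gamma> \<union> fv_tm t" "\<phi> \<in> Pi_closure \<Theta>" "Pi_closure \<Theta> \<subseteq> I" "finite A"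
    and step: "\<And>z. z \<notin> A \<union> fvs \<Gamma> \<union> fv_tm t \<union> fv \<phi> \<union> {x} \<Longrightarrow>
      finsert (less_fm (Var z) t) (finsert (ForallLess x (Var z) \<phi>) \<Gamma>) \<tturnstile> ForallLess x (Succ (Var z)) \<phi>"
  shows "\<Gamma> \<tturnstile> ForallLess x t \<phi>"
proof -
  let ?A = "A \<union> fvs \<Gamma> \<union> fv_tm t \<union> fv \<phi> \<union> {x}"
  have fin: "finite ?A" using assms(4) by (simp add: finite_fv finite_fvs finite_fv_tm)
  obtain z where z: "z \<notin> ?A" using fresh_var[OF fin] by blast
  obtain p where p: "p \<notin> insert z ?A" using fresh_var[of "insert z ?A"] fin by auto
  obtain q where q: "q \<notin> insert p (insert z ?A)" using fresh_var[of "insert p (insert z ?A)"] fin by auto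
  obtain r where r: "r \<notin> insert q (insert p (insert z ?A))"
    using fresh_var[of "insert q (insert p (insert z ?A))"] fin by auto
  let ?X = "\<lambda>s. either p q r x s t \<phi>"
  have fresh: "either_fresh p q r x s t \<phi>" if "s \<in> {Zero, Var z, Succ (Var z), t}" for s
    using p q r z that assms(1) by (auto simp: either_fresh_def)
  have sub: "(?X (Var z))\<langle>s/z\<rangle> = ?X s" if "s \<in> {Zero, Var z, Succ (Var z), t}" for s
    by (subst subst_either) (use p q r z that assms(1) in auto)
  have "\<Gamma> \<tturnstile> (?X (Var z))\<langle>t/z\<rangle>"
  proof (rule Ind_rule)
    show "?X (Var z) \<in> I"
      using either_Pi_closure[OF fresh assms(2)] assms(3) by blast
    have "\<Gamma> \<tturnstile> ForallLess x Zero \<phi>"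
      by (rule ForallLessI[OF not_less_Zero[OF ax]]) (use assms(1) in auto)
    then show "\<Gamma> \<tturnstile> (?X (Var z))\<langle>Zero/z\<rangle>"
      using eitherI1 fresh sub by auto
    have "finsert (?X (Var z)) \<Gamma> \<tturnstile> ?X (Succ (Var z))"
    proof (rule eitherE[OF fresh ax])
      let ?\<Gamma> = "finsert (ForallLess x (Var z) \<phi>) (finsert (?X (Var z)) \<Gamma>)"
      have up: "\<Gamma>' \<tturnstile> ?X (Succ (Var z))"
        if "?\<Gamma> |\<subseteq>| \<Gamma>'" "\<And>y. finsert (less_fm (Var y) t) \<Gamma>' \<tturnstile> less_fm (Var y) (Var z)" for \<Gamma>'
        by (rule eitherI2[OF fresh ForallLess_mono[OF ax[of "ForallLess x (Var z) \<phi>"]]])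
          (use that z assms(1) in auto)
      show "?\<Gamma> \<tturnstile> ?X (Succ (Var z))"
      proof (rule trichotomy[of "Var z" t])
        show "finsert (less_fm (Var z) t) ?\<Gamma> \<tturnstile> ?X (Succ (Var z))"
          by (rule eitherI1[OF fresh wk[OF step[OF z]]]) auto
        show "finsert (Eq (Var z) t) ?\<Gamma> \<tturnstile> ?X (Succ (Var z))"
          by (rule up) (auto intro: less_eq_right ax)
        show "finsert (less_fm t (Var z)) ?\<Gamma> \<tturnstile> ?X (Succ (Var z))"
          by (rule up) (auto intro: less_trans[of _ _ t] ax)
      qed
      show "finsert (ForallLess x t \<phi>) (finsert (?X (Var z)) \<Gamma>) \<tturnstile> ?X (Succ (Var z))"
        by (rule eitherI2[OF fresh ax]) auto
    qed auto
    then show "finsert (?X (Var z)) \<Gamma> \<tturnstile> (?X (Var z))\<langle>Succ (Var z)/z\<rangle>"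
      using sub by simp
  qed (use z in auto)
  then have "\<Gamma> \<tturnstile> ?X t" using sub by simp
  then show ?thesis
    by (rule eitherE[OF fresh, rotated]) (auto intro: ax)
qed

text \<open>The generalised claim is that all formulas hold up to \<open>s\<close> once those
  indexed by \<open>A\<close> are assumed up to \<open>s\<close>. It is trivial for
  \<open>A = K\<close> and descends from there to \<open>A\<close> empty: a further index
  \<open>w\<close> is handled by an induction on \<open>\<Phi> w\<close> alone, which has to stop at
  \<open>s\<close> because the assumptions \<open>H s A\<close> reach no further.\<close>

lemma simultaneous_induction:
  fixes \<Phi> :: "'k \<Rightarrow> fm" and K :: "'k fset" and x :: var
  defines "H s A \<equiv> (\<lambda>k. ForallLess x s (\<Phi> k)) |`| A"
  assumes Pi: "\<And>k. k |\<in>| K \<Longrightarrow> \<Phi> k \<in> Pi_closure \<Theta>" "Pi_closure \<Theta> \<subseteq> I" and x: "x \<notin> fvs \<Delta>"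
    and step: "\<And>s k. x \<notin> fv_tm s \<Longrightarrow> k |\<in>| K \<Longrightarrow> H s K |\<union>| \<Delta> \<tturnstile> ForallLess x (Succ s) (\<Phi> k)"
    and "k |\<in>| K" "x \<notin> fv_tm s"
  shows "\<Delta> \<tturnstile> ForallLess x s (\<Phi> k)"
proof -
  have "H s A |\<union>| \<Delta> \<tturnstile> ForallLess x s (\<Phi> k)"
    if "A |\<subseteq>| K" "x \<notin> fv_tm s" "k |\<in>| K" for A s k
    using that
  proof (induction "fcard (K |-| A)" arbitrary: A s k rule: less_induct)
    case less
    show ?case
    proof (cases "K |\<subseteq>| A")
      case True
      then show ?thesis using less.prems by (auto simp: H_def intro!: ax)
    next
      case False
      then obtain w where w: "w |\<in>| K" "w |\<notin>| A" by auto
      have "fcard (K |-| finsert w A) < fcard (K |-| A)"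
        by (rule pfsubset_fcard_mono) (use w in auto)
      \<comment> \<open>The bound stays arbitrary: the inner induction uses this fact at each
        \<open>z\<close> below \<open>s\<close>.\<close>
      then have IH: "H s (finsert w A) |\<union>| \<Delta> \<tturnstile> ForallLess x s (\<Phi> k)"
        if "x \<notin> fv_tm s" "k |\<in>| K" for s k
        using less.hyps[of "finsert w A" s k] that w less.prems(1) by simp
      let ?\<Gamma> = "H s A |\<union>| \<Delta>"
      have "?\<Gamma> \<tturnstile> ForallLess x s (\<Phi> w)"
      proof (rule bounded_induction[OF _ Pi(1)[OF w(1)] Pi(2), of _ _ _ "{}"])
        show "x \<notin> fvs ?\<Gamma> \<union> fv_tm s"
          using x less.prems(2) by (auto simp: H_def fvs_def fv_ForallLess)
        fix z assume z: "z \<notin> {} \<union> fvs ?\<Gamma> \<union> fv_tm s \<union> fv (\<Phi> w) \<union> {x}"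
        let ?\<Gamma>' = "finsert (less_fm (Var z) s) (finsert (ForallLess x (Var z) (\<Phi> w)) ?\<Gamma>)"
        \<comment> \<open>For \<open>v\<close> in \<open>A\<close> the assumption up to
          \<open>s\<close> is shortened to \<open>z\<close>; for \<open>w\<close> it is the
          hypothesis of the inner induction.\<close>
        have 1: "?\<Gamma>' \<tturnstile> \<phi>" if \<phi>: "\<phi> |\<in>| H (Var z) (finsert w A)" for \<phi>
        proof -
          obtain v where v: "\<phi> = ForallLess x (Var z) (\<Phi> v)" "v = w \<or> v |\<in>| A"
            using \<phi> by (auto simp: H_def)
          show ?thesis
          proof (cases "v = w")
            case False
            then have "ForallLess x s (\<Phi> v) |\<in>| ?\<Gamma>'" using v by (auto simp: H_def)
            then show ?thesis
              unfolding v(1) by (rule ForallLess_mono[OF ax])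
                (use z less.prems(2) in \<open>auto intro: less_trans[of _ _ "Var z"] ax\<close>)
          qed (use v in \<open>auto intro: ax\<close>)
        qed
        \<comment> \<open>The outer hypothesis, taken at the bound \<open>z\<close>, extends this to
          all of \<open>K\<close>, as \<open>step\<close> demands.\<close>
        have 2: "?\<Gamma>' \<tturnstile> \<phi>" if \<phi>: "\<phi> |\<in>| H (Var z) K" for \<phi>
        proof -
          obtain k where "\<phi> = ForallLess x (Var z) (\<Phi> k)" "k |\<in>| K"
            using \<phi> by (auto simp: H_def)
          then have "H (Var z) (finsert w A) |\<union>| \<Delta> \<tturnstile> \<phi>" using IH z by auto
          then show ?thesis by (intro multicut[OF 1]) (auto elim!: wk)
        qed
        show "?\<Gamma>' \<tturnstile> ForallLess x (Succ (Var z)) (\<Phi> w)"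
          by (rule multicut[OF 2 wk[OF step[of "Var z"]]]) (use z w in auto)
      qed auto
      moreover have "H s (finsert w A) = finsert (ForallLess x s (\<Phi> w)) (H s A)"
        by (simp add: H_def)
      ultimately show ?thesis
        using IH[OF less.prems(2,3)] by (auto intro: cut)
    qed
  qed
  from this[of "{||}"] show ?thesis using assms by (simp add: H_def)
qed

text \<open>An equation \<open>y = 0\<close> or \<open>y = Sw\<close> comes from
  \<open>nat_cases\<close>, and rewriting with it turns the sequent into one of the two
  premises.\<close>

lemma Case_rule:
  assumes "y \<notin> fvs \<Delta>" "((\<lambda>\<phi>. \<phi>\<langle>Zero/y\<rangle>) |`| \<Gamma>) |\<union>| \<Delta> \<tturnstile> \<delta>\<langle>Zero/y\<rangle>"
    "((\<lambda>\<phi>. \<phi>\<langle>Succ (Var y)/y\<rangle>) |`| \<Gamma>) |\<union>| \<Delta> \<tturnstile> \<delta>\<langle>Succ (Var y)/y\<rangle>"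
  shows "\<Gamma> |\<union>| \<Delta> \<tturnstile> \<delta>"
proof (rule nat_cases[of "Var y" _ _ "{}"])
  have eq: "finsert (Eq (Var y) t) (\<Gamma> |\<union>| \<Delta>) \<tturnstile> \<delta>"
    if "((\<lambda>\<phi>. \<phi>\<langle>t/y\<rangle>) |`| \<Gamma>) |\<union>| \<Delta> \<tturnstile> \<delta>\<langle>t/y\<rangle>" for t
    using eqL[OF that, of "Var y"] by (simp add: psubst_Var)
  show "finsert (Eq (Var y) Zero) (\<Gamma> |\<union>| \<Delta>) \<tturnstile> \<delta>" by (rule eq[OF assms(2)])
  fix w
  \<comment> \<open>In the premise \<open>y\<close> denotes the predecessor. It is renamed to
    \<open>w\<close>, and \<open>\<Delta>\<close> is unaffected because \<open>y\<close> is not free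
    in it.\<close>
  have "((\<lambda>\<phi>. \<phi>\<langle>Succ (Var y)/y\<rangle>\<langle>Var w/y\<rangle>) |`| \<Gamma>) |\<union>| \<Delta> \<tturnstile> \<delta>\<langle>Succ (Var y)/y\<rangle>\<langle>Var w/y\<rangle>"
    using prv_subst[OF assms(3), where t="Var w" and x=y]
    unfolding fimage_funion psubst_fimage_idle[OF assms(1)] fset.map_comp comp_def .
  moreover have "\<phi>\<langle>Succ (Var y)/y\<rangle>\<langle>Var w/y\<rangle> = \<phi>\<langle>Succ (Var w)/y\<rangle>" for \<phi>
    unfolding psubst_comp by (rule psubst_cong) simp
  ultimately show "finsert (Eq (Var y) (Succ (Var w))) (\<Gamma> |\<union>| \<Delta>) \<tturnstile> \<delta>"
    by (intro eq) (simp only:)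
qed simp

text \<open>A context added to all sequents may contain an eigenvariable. This does no harm if those
  variables of \<open>\<Delta>\<close> that can occur in premises, bounded by \<open>V\<close>, are
  free in the conclusion: a clashing eigenvariable then does not occur in its premise.\<close>

lemma rule_in_context:
  assumes "rule_instance r Ps S" "r \<in> CHA_rules" "\<And>P. P \<in> set Ps \<Longrightarrow> fst P |\<union>| \<Delta> \<tturnstile> snd P"
    and S: "fvs \<Delta> \<inter> V \<subseteq> fv_sequent S" and Ps: "\<And>P. P \<in> set Ps \<Longrightarrow> fv_sequent P \<subseteq> V"
    and Case: "\<And>y. r = Case y \<Longrightarrow> y \<notin> fvs \<Delta>"
  shows "fst S |\<union>| \<Delta> \<tturnstile> snd S"
  using assms(1)
proof cases
  case (10 y \<Gamma> x \<phi>)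
  have prem: "\<Gamma> |\<union>| \<Delta> \<tturnstile> \<phi>\<langle>Var y/x\<rangle>" using assms(3) 10 by simp
  have "\<Gamma> |\<union>| \<Delta> \<tturnstile> Forall x \<phi>"
  proof (cases "y \<in> fvs \<Delta>")
    case False
    then show ?thesis using 10 by (intro AllI[OF prem]) auto
  next
    case True
    moreover have "y \<in> fv (\<phi>\<langle>Var y/x\<rangle>)" if "x \<in> fv \<phi>"
      using that by (force simp: fv_psubst)
    \<comment> \<open>If \<open>x\<close> were free in \<open>\<phi>\<close>, then \<open>y\<close>
      would be a variable of the premise and of \<open>\<Delta>\<close>, hence free in the
      conclusion, against the eigenvariable condition. So the quantifier is vacuous and any fresh
      \<open>z\<close> serves instead.\<close>
    ultimately have "x \<notin> fv \<phi>"
      using S Ps 10 unfolding fv_sequent_def by fastforce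
    moreover obtain z where "z \<notin> fvs (\<Gamma> |\<union>| \<Delta>) \<union> fv (Forall x \<phi>)"
      using fresh_var[of "fvs (\<Gamma> |\<union>| \<Delta>) \<union> fv (Forall x \<phi>)"] finite_fvs finite_fv by blast
    ultimately show ?thesis using prem by (intro AllI[of _ _ z]) (auto simp: psubst_idle)
  qed
  then show ?thesis using 10 by simp
next
  case (11 y \<Gamma> x \<phi> \<delta>)
  have prem: "finsert (\<phi>\<langle>Var y/x\<rangle>) (\<Gamma> |\<union>| \<Delta>) \<tturnstile> \<delta>" using assms(3) 11 by simp
  have "finsert (Exists x \<phi>) (\<Gamma> |\<union>| \<Delta>) \<tturnstile> \<delta>"
  proof (cases "y \<in> fvs \<Delta>")
    case False
    then show ?thesis using 11 by (intro ExL[OF prem]) auto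
  next
    case True
    moreover have "y \<in> fv (\<phi>\<langle>Var y/x\<rangle>)" if "x \<in> fv \<phi>"
      using that by (force simp: fv_psubst)
    ultimately have "x \<notin> fv \<phi>"
      using S Ps 11 unfolding fv_sequent_def by fastforce
    moreover obtain z where "z \<notin> fvs (\<Gamma> |\<union>| \<Delta>) \<union> fv (Exists x \<phi>) \<union> fv \<delta>"
      using fresh_var[of "fvs (\<Gamma> |\<union>| \<Delta>) \<union> fv (Exists x \<phi>) \<union> fv \<delta>"] finite_fvs finite_fv by blast
    ultimately show ?thesis using prem by (intro ExL[of _ z]) (auto simp: psubst_idle)
  qed
  then show ?thesis using 11 by simp
next
  case (14 x y s t \<Gamma> \<delta>)
  then show ?thesis using assms(3) eqL2[of x y s t \<Gamma> \<Delta> \<delta>] by (simp del: fun_upd_apply)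
next
  case (25 x \<Gamma> \<delta>)
  then show ?thesis
    using Case Case_rule[of x \<Delta> \<Gamma> \<delta>] assms(3)[of "hd Ps"] assms(3)[of "hd (tl Ps)"]
    by (simp del: fun_upd_apply)
next
  case (18 t)
  have "{||} \<tturnstile> Imp (Eq Zero (Succ t)) Bot"
    by (rule ImpI, rule Zero_not_Succ, rule ax) simp
  then show ?thesis using 18 by (auto intro: wk)
next
  case (17 \<Gamma> \<phi> \<delta>)
  then show ?thesis using assms(3)[of "hd Ps"] assms(3)[of "hd (tl Ps)"] by (auto intro: cut)
next
  case (16 \<Gamma> \<delta> \<Gamma>')
  then show ?thesis using assms(3) by (auto elim!: wk)
next
  case (24 x \<phi> s)
  then show ?thesis using assms(2) by (auto simp: CHA_rules_def)
next
  case (19 s t)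
  then show ?thesis by (simp add: Succ_inject[OF ax[OF finsertI1]])
next
  case (13 \<Gamma> \<delta>)
  then show ?thesis by (simp add: BotE[OF ax[OF finsertI1]])
next
  case (9 \<phi> t x \<Gamma> \<delta>)
  then show ?thesis using assms(3) by (auto intro!: AllL[of _ t] simp del: fun_upd_apply)
next
  case (12 \<Gamma> \<phi> t x)
  then show ?thesis using assms(3) by (auto intro!: ExI[of _ _ t] simp del: fun_upd_apply)
qed (use assms(3)[of "hd Ps"] assms(3)[of "hd (tl Ps)"] in \<open>auto intro: ax ImpL ImpI AndL AndI OrL OrI1 OrI2 EqI
      Plus_Zero Plus_Succ Times_Zero Times_Succ\<close>)

end

section \<open>Strongly connected sets of nodes\<close>

lemma node_at_append:
  "node_at T (p @ q) = (case node_at T p of None \<Rightarrow> None | Some t \<Rightarrow> node_at t q)"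
  by (induction T p rule: node_at.induct) auto

lemma node_at_child:
  "node_at T p = Some (Infer r S Ts) \<Longrightarrow> i < length Ts \<Longrightarrow> node_at T (p @ [i]) = Some (Ts ! i)"
  by (simp add: node_at_append)

lemma node_at_take: "node_at T p \<noteq> None \<Longrightarrow> node_at T (take n p) \<noteq> None"
  using node_at_append[of T "take n p" "drop n p"] by (auto split: option.splits)

lemma finite_nodes: "finite {p. node_at T p \<noteq> None}"
proof (induction T)
  case (Bud S)
  have "{p. node_at (Bud S) p \<noteq> None} \<subseteq> {[]}"
    by (auto elim: node_at.elims)
  then show ?case by (rule finite_subset) simp
next
  case (Infer r S Ts)
  have "p = [] \<or> (\<exists>i q. i < length Ts \<and> p = i # q \<and> node_at (Ts ! i) q \<noteq> None)"
    if "node_at (Infer r S Ts) p \<noteq> None" for p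
    using that by (cases p) (auto split: if_splits)
  then have "{p. node_at (Infer r S Ts) p \<noteq> None} \<subseteq>
      insert [] (\<Union>i<length Ts. (#) i ` {p. node_at (Ts ! i) p \<noteq> None})"
    by blast
  then show ?case by (rule finite_subset) (use Infer in auto)
qed

lemma trancl_path:
  "(p, q) \<in> E\<^sup>+ \<Longrightarrow> \<exists>ws. successively (\<lambda>a b. (a, b) \<in> E) (p # ws @ [q])"
proof (induction rule: trancl_induct)
  case (base q)
  then show ?case by (intro exI[of _ "[]"]) simp
next
  case (step q r)
  then obtain ws where "successively (\<lambda>a b. (a, b) \<in> E) (p # ws @ [q])" by blast
  then have "successively (\<lambda>a b. (a, b) \<in> E) ((p # ws @ [q]) @ [r])"
    using step.hyps by (subst successively_append_iff) simp
  then show ?case by (intro exI[of _ "ws @ [q]"]) simp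
qed

text \<open>Round trips from \<open>p\<close> through one node after another are concatenated;
  taking indices modulo the length leads from the last node back to \<open>p\<close>.\<close>

lemma closed_walk:
  assumes "finite R" "p \<in> R" "\<And>q q'. q \<in> R \<Longrightarrow> q' \<in> R \<Longrightarrow> (q, q') \<in> (E \<inter> R \<times> R)\<^sup>+"
  shows "\<exists>ws. ws \<noteq> [] \<and> hd ws = p \<and> set ws = R \<and>
    (\<forall>i<length ws. (ws ! i, ws ! (Suc i mod length ws)) \<in> E)"
proof -
  let ?E = "E \<inter> R \<times> R" let ?r = "\<lambda>a b. (a, b) \<in> ?E"
  have "\<exists>ws. successively ?r (p # ws @ [p]) \<and> B \<subseteq> set (p # ws)" if "finite B" "B \<subseteq> R" for B
    using that
  proof (induction B)
    case empty
    then show ?case using trancl_path[OF assms(3)[OF assms(2,2)]] by auto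
  next
    case (insert b B)
    then obtain ws where ws: "successively ?r (p # ws @ [p])" "B \<subseteq> set (p # ws)" by auto
    have b: "b \<in> R" using insert.prems by simp
    obtain us where us: "successively ?r (p # us @ [b])"
      using trancl_path[OF assms(3)[OF assms(2) b]] by auto
    obtain vs where vs: "successively ?r (b # vs @ [p])"
      using trancl_path[OF assms(3)[OF b assms(2)]] by auto
    have "successively ?r ((p # ws @ [p]) @ (us @ [b]) @ (vs @ [p]))"
      using ws(1) us vs by (simp add: successively_append_iff successively_Cons hd_append split: if_splits)
    then show ?case using ws(2) by (intro exI[of _ "ws @ [p] @ us @ [b] @ vs"]) auto
  qed
  from this[OF assms(1)] obtain ws where
    ws: "successively ?r (p # ws @ [p])" "R \<subseteq> set (p # ws)" by blast
  let ?w = "p # ws"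
  have step: "(?w ! i, ?w ! (Suc i mod length ?w)) \<in> ?E" if "i < length ?w" for i
  proof -
    have "((?w @ [p]) ! i, (?w @ [p]) ! Suc i) \<in> ?E"
      using successively_nth[of _ "?w @ [p]" i] ws(1) that by fastforce
    moreover have "(?w @ [p]) ! i = ?w ! i" using that by (simp only: nth_append if_True)
    moreover have "(?w @ [p]) ! Suc i = ?w ! (Suc i mod length ?w)"
      using that by (cases "Suc i = length ?w") (auto simp: nth_append)
    ultimately show ?thesis by simp
  qed
  then have "set ?w \<subseteq> R" by (fastforce simp: set_conv_nth)
  then show ?thesis using ws(2) step by (intro exI[of _ ?w]) auto
qed

definition edges :: "ptree \<Rightarrow> (pos \<rightharpoonup> pos) \<Rightarrow> (pos \<times> pos) set" where
  "edges T \<beta> = {(p, q). node_at T p \<noteq> None \<and>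
    ((\<exists>i. q = p @ [i] \<and> node_at T q \<noteq> None) \<or> \<beta> p = Some q)}"

definition is_case :: "ptree \<Rightarrow> pos \<Rightarrow> var \<Rightarrow> bool" where
  "is_case T p x \<longleftrightarrow> (\<exists>S Ts. node_at T p = Some (Infer (Case x) S Ts))"

text \<open>The global condition speaks of branches from the root. The branch used here descends to
  a node of \<open>R\<close> and then circles through all of \<open>R\<close> forever, so what holds
  eventually along it holds throughout \<open>R\<close>.\<close>

lemma strongly_connected_progress:
  assumes T: "CHA_proof T \<beta>" and R: "R \<noteq> {}" "\<And>p. p \<in> R \<Longrightarrow> node_at T p \<noteq> None"
    and conn: "\<And>p q. p \<in> R \<Longrightarrow> q \<in> R \<Longrightarrow> (p, q) \<in> (edges T \<beta> \<inter> R \<times> R)\<^sup>+"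
  shows "\<exists>x. (\<forall>p\<in>R. x \<in> fv_sequent (sequent_at T p)) \<and> (\<exists>p\<in>R. is_case T p x)"
proof -
  have "finite R" using R(2) by (intro finite_subset[OF _ finite_nodes[of T]]) auto
  obtain p where p: "p \<in> R" using R(1) by blast
  obtain ws where ws: "ws \<noteq> []" "hd ws = p" "set ws = R"
    and step: "\<And>i. i < length ws \<Longrightarrow> (ws ! i, ws ! (Suc i mod length ws)) \<in> edges T \<beta>"
    using closed_walk[OF \<open>finite R\<close> p conn] by blast
  \<comment> \<open>Both parts agree at index \<open>length p\<close>, since the cycle starts with
    \<open>hd ws = p\<close>.\<close>
  define b where "b n = (if n < length p then take n p else ws ! ((n - length p) mod length ws))" for n
  have b_take: "b n = take n p" if "n \<le> length p" for n
    using that ws(1,2) by (auto simp: b_def hd_conv_nth)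
  have "infinite_branch T \<beta> b"
    unfolding infinite_branch_def
  proof (intro conjI allI)
    show "b 0 = []" by (simp add: b_take)
    fix n
    show "(\<exists>i. b (Suc n) = b n @ [i] \<and> node_at T (b (Suc n)) \<noteq> None) \<or> \<beta> (b n) = Some (b (Suc n))"
    proof (cases "n < length p")
      case True
      then have "b (Suc n) = b n @ [p ! n]" by (simp add: b_take take_Suc_conv_app_nth)
      moreover have "node_at T (b (Suc n)) \<noteq> None"
        using True b_take[of "Suc n"] node_at_take R(2)[OF p] by (metis Suc_leI)
      ultimately show ?thesis by blast
    next
      case False
      let ?i = "(n - length p) mod length ws"
      have "(Suc n - length p) mod length ws = Suc ?i mod length ws"
        using False by (simp add: Suc_diff_le mod_Suc_eq)
      then have "(b n, b (Suc n)) \<in> edges T \<beta>"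
        using step[of ?i] False ws(1) by (simp add: b_def)
      then show ?thesis by (auto simp: edges_def)
    qed
  qed
  then obtain x N where x: "\<And>n. n \<ge> N \<Longrightarrow> x \<in> fv_sequent (sequent_at T (b n))"
    and inf: "\<And>N. \<exists>n\<ge>N. is_case T (b n) x"
    using T unfolding CHA_proof_def is_case_def by blast
  have "x \<in> fv_sequent (sequent_at T q)" if q: "q \<in> R" for q
  proof -
    obtain i where i: "i < length ws" "q = ws ! i" using q ws(3) by (metis in_set_conv_nth)
    \<comment> \<open>After \<open>N\<close> full rounds the index is at least \<open>N\<close>, as
      every round has at least one step.\<close>
    have "b (length p + (N * length ws + i)) = q"
      using i by (simp add: b_def)
    moreover have "length p + (N * length ws + i) \<ge> N" using ws(1) by (cases ws) auto
    ultimately show ?thesis using x by metis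
  qed
  moreover have "\<exists>q\<in>R. is_case T q x"
  proof -
    obtain n where n: "n \<ge> length p" "is_case T (b n) x" using inf by blast
    then have "b n = ws ! ((n - length p) mod length ws)" by (simp add: b_def)
    then have "b n \<in> R" using ws(1,3) by (metis length_greater_0_conv mod_less_divisor nth_mem)
    then show ?thesis using n(2) by blast
  qed
  ultimately show ?thesis by blast
qed

section \<open>Translation of cyclic proofs\<close>

definition sequent_formula :: "sequent \<Rightarrow> fm" where
  "sequent_formula S = Imp (conj_set (fset (fst S))) (snd S)"

lemma conj_set_list:
  assumes "finite \<Phi>" obtains \<phi>s where "conj_set \<Phi> = conj_list \<phi>s" "set \<phi>s = \<Phi>"
  using someI_ex[OF finite_distinct_list[OF assms]] unfolding conj_set_def by blast

lemma fv_conj_list: "fv (conj_list \<phi>s) = (\<Union>\<phi>\<in>set \<phi>s. fv \<phi>)"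
  by (induction \<phi>s rule: conj_list.induct) auto

lemma fv_sequent_formula: "fv (sequent_formula S) = fv_sequent S"
proof -
  obtain \<phi>s where "conj_set (fset (fst S)) = conj_list \<phi>s" "set \<phi>s = fset (fst S)"
    by (rule conj_set_list[OF finite_fset])
  then show ?thesis by (simp add: sequent_formula_def fv_sequent_def fvs_def fv_conj_list)
qed

definition Foralls :: "var list \<Rightarrow> fm \<Rightarrow> fm" where
  "Foralls xs \<phi> = foldr Forall xs \<phi>"

lemma Foralls_Pi_closure: "\<phi> \<in> Pi_closure \<Theta> \<Longrightarrow> Foralls xs \<phi> \<in> Pi_closure \<Theta>"
  unfolding Foralls_def by (induction xs) (auto intro: Pi_closure.intros(4))

lemma fv_Foralls: "fv (Foralls xs \<phi>) = fv \<phi> - set xs"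
  unfolding Foralls_def by (induction xs) (auto simp: fv_Forall)

context restricted_HA
begin

section \<open>Passing between sequents and their formulas\<close>

lemma conj_listI: "(\<And>\<phi>. \<phi> \<in> set \<phi>s \<Longrightarrow> \<Gamma> \<tturnstile> \<phi>) \<Longrightarrow> \<Gamma> \<tturnstile> conj_list \<phi>s"
  by (induction \<phi>s rule: conj_list.induct) (auto intro: AndI ImpI ax)

lemma conj_listD: "\<Gamma> \<tturnstile> conj_list \<phi>s \<Longrightarrow> \<phi> \<in> set \<phi>s \<Longrightarrow> \<Gamma> \<tturnstile> \<phi>"
  by (induction \<phi>s rule: conj_list.induct) (auto dest: AndD1 AndD2)

lemma sequent_formulaI:
  assumes "fst S |\<union>| \<Delta> \<tturnstile> snd S"
  shows "\<Delta> \<tturnstile> sequent_formula S"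
proof -
  obtain \<phi>s where \<phi>s: "conj_set (fset (fst S)) = conj_list \<phi>s" "set \<phi>s = fset (fst S)"
    by (rule conj_set_list[OF finite_fset])
  have "finsert (conj_list \<phi>s) \<Delta> \<tturnstile> snd S"
    by (rule multicut[of "fst S"])
      (use \<phi>s(2) assms in \<open>auto intro: conj_listD[OF ax[OF finsertI1]] elim!: wk\<close>)
  then show ?thesis by (simp add: sequent_formula_def \<phi>s(1) ImpI)
qed

lemma sequent_formulaD:
  assumes "\<Delta> \<tturnstile> sequent_formula S"
  shows "fst S |\<union>| \<Delta> \<tturnstile> snd S"
proof -
  obtain \<phi>s where \<phi>s: "conj_set (fset (fst S)) = conj_list \<phi>s" "set \<phi>s = fset (fst S)"
    by (rule conj_set_list[OF finite_fset])
  have "fst S |\<union>| \<Delta> \<tturnstile> conj_list \<phi>s"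
    by (rule conj_listI) (auto simp: \<phi>s(2) intro: ax)
  moreover have "fst S |\<union>| \<Delta> \<tturnstile> Imp (conj_list \<phi>s) (snd S)"
    using assms unfolding sequent_formula_def \<phi>s(1) by (rule wk) auto
  ultimately show ?thesis by (blast intro: ImpE)
qed

lemma ForallsI: "\<Gamma> \<tturnstile> \<phi> \<Longrightarrow> set xs \<inter> fvs \<Gamma> = {} \<Longrightarrow> \<Gamma> \<tturnstile> Foralls xs \<phi>"
  unfolding Foralls_def by (induction xs) (auto intro: AllI_same)

lemma ForallsE: "\<Gamma> \<tturnstile> Foralls xs \<phi> \<Longrightarrow> \<Gamma> \<tturnstile> \<phi>"
  unfolding Foralls_def
proof (induction xs)
  case (Cons x xs)
  then show ?case using AllE[of \<Gamma> x _ "Var x"] by (simp add: psubst_Var)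
qed simp

end

text \<open>The induction formulas are built from the sequents at companions, whence the assumption
  on the latter.\<close>

locale restricted_CHA_proof = restricted_HA +
  fixes T :: ptree and \<beta> :: "pos \<rightharpoonup> pos" and \<Theta> :: "fm set"
  assumes CHA: "CHA_proof T \<beta>"
    and Pi_closure_subset: "Pi_closure (sequent_formulas \<Theta>) \<subseteq> I"
    and companions: "\<And>q. q \<in> ran \<beta> \<Longrightarrow> sequent_formula (sequent_at T q) \<in> sequent_formulas \<Theta>"
begin

section \<open>Provability at single nodes of the cyclic proof\<close>

definition nodes :: "pos set" where
  "nodes = {p. node_at T p \<noteq> None}"

abbreviation fv_at :: "pos \<Rightarrow> var set" where
  "fv_at p \<equiv> fv_sequent (sequent_at T p)"

text \<open>Case variables are listed separately because a case variable need not be free in its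
  sequent. A variable outside \<open>vars\<close> is neither free at a node nor split
  anywhere.\<close>

definition vars :: "var set" where
  "vars = (\<Union>p\<in>nodes. fv_at p) \<union> {x. \<exists>p. is_case T p x}"

definition proves :: "fm fset \<Rightarrow> pos \<Rightarrow> bool" where
  "proves \<Delta> p \<longleftrightarrow> fst (sequent_at T p) |\<union>| \<Delta> \<tturnstile> snd (sequent_at T p)"

lemma preproof: "CHA_preproof T \<beta>"
  using CHA by (simp add: CHA_proof_def)

lemma finite_node_set: "finite nodes"
  unfolding nodes_def by (rule finite_nodes)

lemma finite_vars: "finite vars"
proof -
  have "finite (\<Union>p\<in>nodes. fv_at p)"
    by (simp add: finite_node_set fv_sequent_def finite_fv finite_fvs)
  moreover have "{x. \<exists>p. is_case T p x} \<subseteq>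
      (\<lambda>p. THE x. is_case T p x) ` nodes"
  proof
    fix x assume "x \<in> {x. \<exists>p. is_case T p x}"
    then obtain p where "is_case T p x" by blast
    then have "x = (THE x. is_case T p x)" "p \<in> nodes"
      by (auto simp: is_case_def nodes_def)
    then show "x \<in> (\<lambda>p. THE x. is_case T p x) ` nodes" by blast
  qed
  then have "finite {x. \<exists>p. is_case T p x}"
    by (rule finite_subset) (simp add: finite_node_set)
  ultimately show ?thesis by (simp add: vars_def)
qed

lemma fv_at_vars: "p \<in> nodes \<Longrightarrow> fv_at p \<subseteq> vars"
  by (auto simp: vars_def)

lemma is_case_vars: "is_case T p x \<Longrightarrow> x \<in> vars"
  by (auto simp: vars_def)

lemma edge_node: "(p, q) \<in> edges T \<beta> \<Longrightarrow> q \<in> nodes"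
  using preproof by (auto simp: edges_def nodes_def CHA_preproof_def inner_nodes_def ran_def)

lemma proves_wk: "proves \<Delta> p \<Longrightarrow> \<Delta> |\<subseteq>| \<Delta>' \<Longrightarrow> proves \<Delta>' p"
  unfolding proves_def by (erule wk) auto

lemma rule_at:
  assumes "node_at T p = Some (Infer r S Ts)"
  shows "r \<in> CHA_rules" "rule_instance r (map concl Ts) S" "sequent_at T p = S"
    and "i < length Ts \<Longrightarrow> sequent_at T (p @ [i]) = concl (Ts ! i)"
    and "i < length Ts \<Longrightarrow> (p, p @ [i]) \<in> edges T \<beta>"
proof -
  show "r \<in> CHA_rules" "rule_instance r (map concl Ts) S"
    using assms preproof unfolding CHA_preproof_def locally_correct_def by blast+
qed (use assms in \<open>auto simp: sequent_at_def node_at_child edges_def\<close>)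

text \<open>A bud counts as a node whose successor is its companion, with the same sequent, so buds
  and rule instances are treated alike. For rule instances this is \<open>rule_in_context\<close>
  with \<open>V = vars\<close>.\<close>

lemma local_step:
  assumes "p \<in> nodes" and edges: "\<And>q. (p, q) \<in> edges T \<beta> \<Longrightarrow> proves \<Delta> q"
    and "fvs \<Delta> \<inter> vars \<subseteq> fv_at p" and case_: "\<And>x. is_case T p x \<Longrightarrow> x \<notin> fvs \<Delta>"
  shows "proves \<Delta> p"
proof -
  obtain t where t: "node_at T p = Some t" using assms(1) by (auto simp: nodes_def)
  show ?thesis
  proof (cases t)
    case (Bud S)
    then have "p \<in> dom \<beta>" using t preproof by (auto simp: CHA_preproof_def buds_def)
    then obtain q where q: "\<beta> p = Some q" by blast
    then have "(p, q) \<in> edges T \<beta>" using t by (simp add: edges_def)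
    moreover have "sequent_at T p = sequent_at T q"
      using q preproof by (auto simp: CHA_preproof_def)
    ultimately show ?thesis using edges by (simp add: proves_def)
  next
    case (Infer r S Ts)
    note node = t[unfolded Infer]
    have prem: "\<exists>q. (p, q) \<in> edges T \<beta> \<and> P = sequent_at T q" if "P \<in> set (map concl Ts)" for P
    proof -
      obtain i where i: "i < length Ts" "P = concl (Ts ! i)"
        using \<open>P \<in> set (map concl Ts)\<close> by (metis in_set_conv_nth length_map nth_map)
      then show ?thesis using rule_at(4,5)[OF node i(1)] by metis
    qed
    have "fst S |\<union>| \<Delta> \<tturnstile> snd S"
    proof (rule rule_in_context[OF rule_at(2,1)[OF node]])
      show "fst P |\<union>| \<Delta> \<tturnstile> snd P" if "P \<in> set (map concl Ts)" for P
        using prem[OF that] edges by (auto simp: proves_def)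
      show "fv_sequent P \<subseteq> vars" if "P \<in> set (map concl Ts)" for P
        using prem[OF that] edge_node fv_at_vars by blast
      show "fvs \<Delta> \<inter> vars \<subseteq> fv_sequent S"
        using assms(3) rule_at(3)[OF node] by simp
      show "y \<notin> fvs \<Delta>" if "r = Case y" for y
        using case_ node that by (auto simp: is_case_def)
    qed
    then show ?thesis using rule_at(3)[OF node] by (simp add: proves_def)
  qed
qed

text \<open>In the successor premise \<open>x\<close> stands for the predecessor, so
  \<open>x < u\<close> at the conclusion becomes \<open>Sx < u\<close>. Two instances occur:
  \<open>u = z\<close> merely keeps the bound, while \<open>u = Sz\<close> lowers it to
  \<open>z\<close>, which is the progress made at a case node.\<close>

lemma case_step:
  assumes "is_case T p x" "x \<notin> fvs \<Delta>"
    and zero: "\<And>q. (p, q) \<in> edges T \<beta> \<Longrightarrow> x \<notin> fv_at q \<Longrightarrow> proves \<Delta> q"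
    and succ: "\<And>q. (p, q) \<in> edges T \<beta> \<Longrightarrow> proves (finsert (less_fm (Var x) z) \<Delta>) q"
    and less: "{|less_fm (Succ (Var x)) u|} \<tturnstile> less_fm (Var x) z" and u: "x \<notin> fv_tm u"
  shows "proves (finsert (less_fm (Var x) u) \<Delta>) p"
proof -
  obtain S Ts where node: "node_at T p = Some (Infer (Case x) S Ts)"
    using assms(1) by (auto simp: is_case_def)
  obtain \<Gamma> \<delta> where S: "S = (\<Gamma> \<turnstile> \<delta>)" and Ts: "map concl Ts =
      [(\<lambda>\<phi>. \<phi>\<langle>Zero/x\<rangle>) |`| \<Gamma> \<turnstile> \<delta>\<langle>Zero/x\<rangle>, (\<lambda>\<phi>. \<phi>\<langle>Succ (Var x)/x\<rangle>) |`| \<Gamma> \<turnstile> \<delta>\<langle>Succ (Var x)/x\<rangle>]"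
    using rule_at(2)[OF node] by (cases rule: rule_instance.cases) auto
  have len: "0 < length Ts" "1 < length Ts" using arg_cong[OF Ts, of length] by auto
  have S0: "sequent_at T (p @ [0]) = ((\<lambda>\<phi>. \<phi>\<langle>Zero/x\<rangle>) |`| \<Gamma> \<turnstile> \<delta>\<langle>Zero/x\<rangle>)"
    using rule_at(4)[OF node len(1)] arg_cong[OF Ts, of "\<lambda>xs. xs ! 0"] len(1) by simp
  have S1: "sequent_at T (p @ [1]) = ((\<lambda>\<phi>. \<phi>\<langle>Succ (Var x)/x\<rangle>) |`| \<Gamma> \<turnstile> \<delta>\<langle>Succ (Var x)/x\<rangle>)"
    using rule_at(4)[OF node len(2)] arg_cong[OF Ts, of "\<lambda>xs. xs ! 1"] len(2) by simp
  have "x \<notin> fv_at (p @ [0])"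
    unfolding S0 by (auto simp: fv_sequent_def fvs_def fv_psubst split: if_splits)
  then have "proves \<Delta> (p @ [0])" by (rule zero[OF rule_at(5)[OF node len(1)]])
  then have 0: "((\<lambda>\<phi>. \<phi>\<langle>Zero/x\<rangle>) |`| \<Gamma>) |\<union>| \<Delta> \<tturnstile> \<delta>\<langle>Zero/x\<rangle>"
    by (simp only: proves_def S0 fst_conv snd_conv)
  have 1: "((\<lambda>\<phi>. \<phi>\<langle>Succ (Var x)/x\<rangle>) |`| \<Gamma>) |\<union>| finsert (less_fm (Var x) z) \<Delta> \<tturnstile> \<delta>\<langle>Succ (Var x)/x\<rangle>"
    using succ[OF rule_at(5)[OF node len(2)]] by (simp only: proves_def S1 fst_conv snd_conv)
  have sub: "(less_fm (Var x) u)\<langle>t/x\<rangle> = less_fm t u" for t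
    using u by (simp add: psubst_less psubst_tm_idle)
  have "finsert (less_fm (Var x) u) \<Gamma> |\<union>| \<Delta> \<tturnstile> \<delta>"
  proof (rule Case_rule[OF assms(2)])
    show "((\<lambda>\<phi>. \<phi>\<langle>Zero/x\<rangle>) |`| finsert (less_fm (Var x) u) \<Gamma>) |\<union>| \<Delta> \<tturnstile> \<delta>\<langle>Zero/x\<rangle>"
      using 0 by (rule wk) auto
    have "((\<lambda>\<phi>. \<phi>\<langle>Succ (Var x)/x\<rangle>) |`| finsert (less_fm (Var x) u) \<Gamma>) |\<union>| \<Delta> \<tturnstile> less_fm (Var x) z"
      by (rule wk[OF less]) (simp only: fimage_finsert sub, simp)
    then show "((\<lambda>\<phi>. \<phi>\<langle>Succ (Var x)/x\<rangle>) |`| finsert (less_fm (Var x) u) \<Gamma>) |\<union>| \<Delta> \<tturnstile> \<delta>\<langle>Succ (Var x)/x\<rangle>"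
      by (rule cut) (rule wk[OF 1], auto)
  qed
  then show ?thesis using rule_at(3)[OF node] by (simp add: proves_def S)
qed

text \<open>The variables of \<open>\<Delta>\<close> that occur in the proof are those whose value is fixed within the region.\<close>

definition region :: "fm fset \<Rightarrow> pos set \<Rightarrow> bool" where
  "region \<Delta> R \<longleftrightarrow> R \<subseteq> nodes \<and>
    (\<forall>p\<in>R. fvs \<Delta> \<inter> vars \<subseteq> fv_at p \<and> (\<forall>x. is_case T p x \<longrightarrow> x \<notin> fvs \<Delta>) \<and>
      (\<forall>q. (p, q) \<in> edges T \<beta> \<longrightarrow> q \<notin> R \<longrightarrow> proves \<Delta> q))"

text \<open>Let all companions in \<open>R\<close> be assumed for values of \<open>x\<close> below
  \<open>z\<close>. Then every node of \<open>R\<close> is provable for \<open>x < z\<close>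
  (\<open>below\<close>), the nodes splitting \<open>x\<close> even for \<open>x < Sz\<close>
  (\<open>case_nodes\<close>), and with these as exits the smaller region gives all nodes for
  \<open>x < Sz\<close> (\<open>upto\<close>). This is the step of a simultaneous induction, which
  discharges the assumption.\<close>

lemma region_strongly_connected:
  assumes IH: "\<And>R' \<Delta>'. R' \<subset> R \<Longrightarrow> region \<Delta>' R' \<Longrightarrow> \<forall>p\<in>R'. proves \<Delta>' p"
    and R: "region \<Delta> R" and x: "\<And>p. p \<in> R \<Longrightarrow> x \<in> fv_at p" and case_: "\<exists>p\<in>R. is_case T p x"
    and "p \<in> R"
  shows "proves \<Delta> p"
proof -
  have nodes: "p \<in> nodes" if "p \<in> R" for p using R that by (auto simp: region_def)
  have fixed: "fvs \<Delta> \<inter> vars \<subseteq> fv_at p" if "p \<in> R" for p using R that by (auto simp: region_def)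
  have not_fixed: "y \<notin> fvs \<Delta>" if "p \<in> R" "is_case T p y" for p y
    using R that by (auto simp: region_def)
  have exits: "proves \<Delta> q" if "p \<in> R" "(p, q) \<in> edges T \<beta>" "q \<notin> R" for p q
    using R that by (auto simp: region_def)
  have xV: "x \<in> vars" and x\<Delta>: "x \<notin> fvs \<Delta>"
    using case_ is_case_vars not_fixed by auto
  have "finite R" by (rule finite_subset[OF _ finite_node_set]) (use nodes in auto)
  then obtain K where K: "fset K = R \<inter> ran \<beta>"
    by (metis finite_Int fset_cases mem_Collect_eq)
  define F where "F k = sequent_formula (sequent_at T k)" for k
  \<comment> \<open>The remaining variables may change their values on the way round a cycle, so
    they are generalised in the induction formula. Only \<open>x\<close> and the variables of
    \<open>\<Delta>\<close> stay free.\<close>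
  define rest where "rest k = sorted_list_of_set (fv_at k - insert x (fvs \<Delta>))" for k
  define \<Phi> where "\<Phi> k = Foralls (rest k) (F k)" for k
  have rest: "set (rest k) = fv_at k - insert x (fvs \<Delta>)" for k
    by (simp add: rest_def fv_sequent_def finite_fv finite_fvs)
  have fv\<Phi>: "fv (\<Phi> k) \<subseteq> insert x (fvs \<Delta>)" for k
    by (auto simp: \<Phi>_def fv_Foralls rest F_def fv_sequent_formula)
  have \<Phi>Pi: "\<Phi> k \<in> Pi_closure (sequent_formulas \<Theta>)" if "k |\<in>| K" for k
    unfolding \<Phi>_def F_def
    by (intro Foralls_Pi_closure Pi_closure.intros(1) companions) (use that K in auto)
  define H where "H s = (\<lambda>k. ForallLess x s (\<Phi> k)) |`| K" for s
  obtain z where z: "z \<notin> insert x (vars \<union> fvs \<Delta>)"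
    using fresh_var[of "insert x (vars \<union> fvs \<Delta>)"] by (auto simp: finite_vars finite_fvs)
  let ?\<Delta> = "H (Var z) |\<union>| \<Delta>"
  have fvH: "fvs ?\<Delta> \<subseteq> insert z (fvs \<Delta>)"
    using fv\<Phi> by (auto simp: H_def fvs_def fv_ForallLess)
  then have x\<Delta>': "x \<notin> fvs ?\<Delta>" using x\<Delta> z by auto
  \<comment> \<open>A bound on \<open>x\<close> in the context makes \<open>x\<close> one of the
    fixed variables, which is allowed because it is free at every node of \<open>R\<close>;
    \<open>z\<close> lies outside \<open>vars\<close>.\<close>
  have fixed': "fvs (finsert (less_fm (Var x) u) ?\<Delta>) \<inter> vars \<subseteq> fv_at p"
    if "p \<in> R" "fv_tm u = {z}" for p u
    using fixed[OF that(1)] fvH z x[OF that(1)] that(2) by (auto simp: fv_less)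
  have not_fixed': "y \<notin> fvs (finsert (less_fm (Var x) u) ?\<Delta>)"
    if "p \<in> R" "is_case T p y" "\<not> is_case T p x" "fv_tm u = {z}" for p y u
  proof -
    have "y \<noteq> x" "y \<in> vars" using that is_case_vars by auto
    then show ?thesis using not_fixed[OF that(1,2)] fvH z that(4) by (auto simp: fv_less)
  qed
  \<comment> \<open>Induction on the subtree at \<open>p\<close>: steps to children within
    \<open>R\<close> shrink the tree, and steps to companions are covered by
    \<open>H (Var z)\<close>.\<close>
  have below: "proves (finsert (less_fm (Var x) (Var z)) ?\<Delta>) p" if "p \<in> R" "node_at T p = Some t" for p t
    using that
  proof (induction t arbitrary: p)
    have *: "proves (finsert (less_fm (Var x) (Var z)) ?\<Delta>) p"
      if p: "p \<in> R"
        and child: "\<And>i. p @ [i] \<in> R \<Longrightarrow> proves (finsert (less_fm (Var x) (Var z)) ?\<Delta>) (p @ [i])" for p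
    proof -
      let ?\<Delta>' = "finsert (less_fm (Var x) (Var z)) ?\<Delta>"
      have edge: "proves ?\<Delta>' q" if q: "(p, q) \<in> edges T \<beta>" for q
      proof (cases "q \<in> R")
        case False
        show ?thesis by (rule proves_wk[OF exits[OF p q False]]) auto
      next
        case True
        show ?thesis
        proof (cases "\<exists>i. q = p @ [i]")
          case False
          then have "q |\<in>| K" using q True K by (auto simp: edges_def ran_def)
          then have "?\<Delta>' \<tturnstile> ForallLess x (Var z) (\<Phi> q)" by (auto simp: H_def intro: ax)
          then have "?\<Delta>' \<tturnstile> (\<Phi> q)\<langle>Var x/x\<rangle>"
            by (rule ForallLessE) (use z in \<open>auto intro: ax\<close>)
          then have "?\<Delta>' \<tturnstile> F q"
            by (auto simp: psubst_Var \<Phi>_def intro: ForallsE)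
          then show ?thesis by (simp only: F_def proves_def sequent_formulaD)
        qed (use child True in auto)
      qed
      show ?thesis
      proof (cases "is_case T p x")
        case True
        show ?thesis
        proof (rule case_step[OF True x\<Delta>' _ edge])
          \<comment> \<open>A successor in which \<open>x\<close> is not free, such as the zero
            premise, lies outside \<open>R\<close> and is therefore an exit.\<close>
          show "proves ?\<Delta> q" if "(p, q) \<in> edges T \<beta>" "x \<notin> fv_at q" for q
            using exits[OF p that(1)] x that(2) by (auto intro: proves_wk)
          show "{|less_fm (Succ (Var x)) (Var z)|} \<tturnstile> less_fm (Var x) (Var z)"
            by (rule less_trans[OF less_Succ_self ax]) simp
        qed (use z in auto)
      next
        case False
        show ?thesis
          by (rule local_step[OF nodes[OF p] edge fixed'[OF p] not_fixed'[OF p _ False]]) auto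
      qed
    qed
    {
      case (Bud S)
      show ?case
        by (rule *[OF Bud.prems(1)]) (use nodes Bud.prems(2) in \<open>fastforce simp: nodes_def node_at_append\<close>)
    next
      case (Infer r S Ts)
      show ?case
      proof (rule *[OF Infer.prems(1)])
        fix i assume "p @ [i] \<in> R"
        then have "i < length Ts"
          using nodes Infer.prems(2) by (fastforce simp: nodes_def node_at_append split: if_splits)
        then show "proves (finsert (less_fm (Var x) (Var z)) ?\<Delta>) (p @ [i])"
          using Infer.IH[of "Ts ! i" "p @ [i]"] \<open>p @ [i] \<in> R\<close> Infer.prems(2)
          by (simp add: node_at_child)
      qed
    }
  qed
  let ?\<Delta>' = "finsert (less_fm (Var x) (Succ (Var z))) ?\<Delta>"
  let ?C = "{p \<in> R. is_case T p x}"
  have case_nodes: "proves ?\<Delta>' p" if p: "p \<in> ?C" for p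
  proof (rule case_step[OF _ x\<Delta>'])
    show "is_case T p x" using p by simp
    show "proves ?\<Delta> q" if "(p, q) \<in> edges T \<beta>" "x \<notin> fv_at q" for q
      using exits[OF _ that(1)] p x that(2) by (auto intro: proves_wk)
    show "proves (finsert (less_fm (Var x) (Var z)) ?\<Delta>) q" if "(p, q) \<in> edges T \<beta>" for q
    proof (cases "q \<in> R")
      case True
      then show ?thesis using below nodes[OF True] by (auto simp: nodes_def)
    next
      case False
      show ?thesis by (rule proves_wk[OF exits[OF _ that False]]) (use p in auto)
    qed
    show "{|less_fm (Succ (Var x)) (Succ (Var z))|} \<tturnstile> less_fm (Var x) (Var z)"
      by (rule Succ_less_Succ[OF ax]) simp
  qed (use z in auto)
  have upto: "proves ?\<Delta>' p" if "p \<in> R" for p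
  proof (cases "p \<in> ?C")
    case False
    \<comment> \<open>Once the nodes splitting \<open>x\<close> are gone, its value no longer
      changes and \<open>x < Sz\<close> may join the context. The removed nodes become exits that
      are already proved.\<close>
    have "region ?\<Delta>' (R - ?C)"
      unfolding region_def
    proof (intro conjI ballI allI impI)
      show "R - ?C \<subseteq> nodes" using nodes by auto
      fix p assume p: "p \<in> R - ?C"
      show "fvs ?\<Delta>' \<inter> vars \<subseteq> fv_at p" by (rule fixed') (use p in auto)
      show "y \<notin> fvs ?\<Delta>'" if "is_case T p y" for y
        by (rule not_fixed'[OF _ that]) (use p in auto)
      fix q assume q: "(p, q) \<in> edges T \<beta>" "q \<notin> R - ?C"
      show "proves ?\<Delta>' q"
      proof (cases "q \<in> ?C")
        case True
        then show ?thesis by (rule case_nodes)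
      next
        case False
        then have "proves \<Delta> q" using exits[of p q] p q by auto
        then show ?thesis by (rule proves_wk) auto
      qed
    qed
    moreover have "R - ?C \<subset> R" using case_ by auto
    ultimately show ?thesis using IH[of "R - ?C" ?\<Delta>'] that False by blast
  qed (rule case_nodes)
  have H_subst: "(\<lambda>\<phi>. \<phi>\<langle>s/z\<rangle>) |`| H (Var z) = H s" if "x \<notin> fv_tm s" for s
    unfolding H_def fset.map_comp
  proof (rule fset.map_cong0)
    fix k
    have "z \<notin> fv (\<Phi> k)" using fv\<Phi>[of k] z by auto
    then show "((\<lambda>\<phi>. \<phi>\<langle>s/z\<rangle>) \<circ> (\<lambda>k. ForallLess x (Var z) (\<Phi> k))) k = ForallLess x s (\<Phi> k)"
      using z that by (simp add: subst_ForallLess psubst_idle)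
  qed
  have z\<Delta>: "z \<notin> fvs \<Delta>" using z by simp
  have step: "H s |\<union>| \<Delta> \<tturnstile> ForallLess x (Succ s) (\<Phi> k)" if "x \<notin> fv_tm s" "k |\<in>| K" for s k
  proof -
    have k: "k \<in> R" using that(2) K by auto
    have "?\<Delta>' \<tturnstile> F k"
      using upto[OF k] unfolding F_def proves_def by (rule sequent_formulaI)
    moreover have "set (rest k) \<inter> fvs ?\<Delta>' = {}"
      using fvH z fv_at_vars[OF nodes[OF k]] by (auto simp: rest fv_less)
    ultimately have "?\<Delta>' \<tturnstile> \<Phi> k" unfolding \<Phi>_def by (rule ForallsI)
    then have "?\<Delta> \<tturnstile> ForallLess x (Succ (Var z)) (\<Phi> k)"
      by (rule ForallLessI) (rule x\<Delta>')
    then have "((\<lambda>\<phi>. \<phi>\<langle>s/z\<rangle>) |`| ?\<Delta>) \<tturnstile> (ForallLess x (Succ (Var z)) (\<Phi> k))\<langle>s/z\<rangle>"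
      by (rule prv_subst)
    moreover have "z \<notin> fv (\<Phi> k)" using fv\<Phi>[of k] z by auto
    then have "(ForallLess x (Succ (Var z)) (\<Phi> k))\<langle>s/z\<rangle> = ForallLess x (Succ s) (\<Phi> k)"
      using z that(1) by (simp add: subst_ForallLess psubst_idle)
    ultimately show ?thesis
      unfolding fimage_funion H_subst[OF that(1)] psubst_fimage_idle[OF z\<Delta>] by simp
  qed
  have all: "\<Delta> \<tturnstile> ForallLess x (Var z) (\<Phi> k)" if "k |\<in>| K" for k
    by (rule simultaneous_induction[OF \<Phi>Pi Pi_closure_subset x\<Delta> step[unfolded H_def] that])
      (use z in auto)
  let ?\<Gamma> = "fst (sequent_at T p)" and ?\<delta> = "snd (sequent_at T p)"
  have "?\<Gamma> |\<union>| finsert (less_fm (Var x) (Succ (Var z))) \<Delta> \<tturnstile> ?\<delta>"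
  proof (rule multicut[of "H (Var z)"])
    show "?\<Gamma> |\<union>| finsert (less_fm (Var x) (Succ (Var z))) \<Delta> \<tturnstile> \<phi>" if "\<phi> |\<in>| H (Var z)" for \<phi>
      using that by (auto simp: H_def intro!: wk[OF all])
    show "H (Var z) |\<union>| (?\<Gamma> |\<union>| finsert (less_fm (Var x) (Succ (Var z))) \<Delta>) \<tturnstile> ?\<delta>"
      using upto[OF \<open>p \<in> R\<close>] unfolding proves_def by (rule wk) auto
  qed
  \<comment> \<open>Choosing \<open>z\<close> to be \<open>x\<close> turns the remaining hypothesis
    into \<open>x < Sx\<close>, which is provable.\<close>
  note prv_subst[OF this, where t = "Var x" and x = z]
  moreover have "(\<lambda>\<phi>. \<phi>\<langle>Var x/z\<rangle>) |`| ?\<Gamma> = ?\<Gamma>" "?\<delta>\<langle>Var x/z\<rangle> = ?\<delta>"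
    using z fv_at_vars[OF nodes[OF \<open>p \<in> R\<close>]]
    by (auto simp: fv_sequent_def intro!: psubst_fimage_idle psubst_idle)
  moreover have "(less_fm (Var x) (Succ (Var z)))\<langle>Var x/z\<rangle> = less_fm (Var x) (Succ (Var x))"
    using z by (simp add: psubst_less)
  ultimately have "?\<Gamma> |\<union>| finsert (less_fm (Var x) (Succ (Var x))) \<Delta> \<tturnstile> ?\<delta>"
    unfolding fimage_funion fimage_finsert psubst_fimage_idle[OF z\<Delta>] by metis
  then show ?thesis
    unfolding proves_def by (rule cut[OF less_Succ_self[of _ "Var x"] wk]) auto
qed

text \<open>Induction on the size of \<open>R\<close>. If some \<open>q\<close> does not reach some
  \<open>q'\<close> inside \<open>R\<close>, the part reachable from \<open>q\<close> is closed
  under successors in \<open>R\<close> and omits \<open>q'\<close>, so it is a smaller region. It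
  yields the successors of \<open>q\<close> and hence \<open>q\<close>, which then becomes an exit
  of the smaller region \<open>R - {q}\<close>. Otherwise \<open>R\<close> is strongly
  connected.\<close>

lemma region_proves:
  assumes "region \<Delta> R" "p \<in> R"
  shows "proves \<Delta> p"
  using assms
proof (induction "card R" arbitrary: R \<Delta> p rule: less_induct)
  case less
  have "finite R"
    by (rule finite_subset[OF _ finite_node_set]) (use less.prems in \<open>simp add: region_def\<close>)
  then have IH: "\<forall>p\<in>R'. proves \<Delta>' p" if "R' \<subset> R" "region \<Delta>' R'" for R' \<Delta>'
    using less.hyps[OF psubset_card_mono] that by blast
  let ?E = "edges T \<beta> \<inter> R \<times> R"
  show ?case
  proof (cases "\<forall>q\<in>R. \<forall>q'\<in>R. (q, q') \<in> ?E\<^sup>+")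
    case True
    have "\<exists>x. (\<forall>p\<in>R. x \<in> fv_at p) \<and> (\<exists>p\<in>R. is_case T p x)"
      by (rule strongly_connected_progress[OF CHA])
        (use True less.prems in \<open>auto simp: region_def nodes_def\<close>)
    then show ?thesis using region_strongly_connected[OF IH less.prems(1)] less.prems(2) by blast
  next
    case False
    then obtain q q' where q: "q \<in> R" "q' \<in> R" "(q, q') \<notin> ?E\<^sup>+" by blast
    let ?R = "{r \<in> R. (q, r) \<in> ?E\<^sup>+}"
    have "q'' \<in> ?R" if "p \<in> ?R" "(p, q'') \<in> edges T \<beta>" "q'' \<in> R" for p q''
      using that by (auto intro: trancl_into_trancl)
    then have "region \<Delta> ?R"
      using less.prems(1) unfolding region_def by blast
    moreover have "?R \<subset> R" using q by auto
    ultimately have R: "\<forall>p\<in>?R. proves \<Delta> p" by (rule IH[rotated])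
    have "proves \<Delta> q"
    proof (rule local_step)
      fix r assume r: "(q, r) \<in> edges T \<beta>"
      show "proves \<Delta> r"
      proof (cases "r \<in> R")
        case True
        then have "r \<in> ?R" using r q(1) by auto
        then show ?thesis using R by blast
      qed (use less.prems(1) q(1) r in \<open>auto simp: region_def\<close>)
    qed (use less.prems(1) q(1) in \<open>auto simp: region_def\<close>)
    then have "region \<Delta> (R - {q})"
      using less.prems(1) unfolding region_def by auto
    moreover have "R - {q} \<subset> R" using q(1) by auto
    ultimately have "\<forall>p\<in>R - {q}. proves \<Delta> p" by (rule IH[rotated])
    then show ?thesis using \<open>proves \<Delta> q\<close> less.prems(2) by blast
  qed
qed

text \<open>The set of all nodes is a region for the empty context: it has no exits, and no variable
  is fixed.\<close>

lemma root_proves: "fst (concl T) \<tturnstile> snd (concl T)"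
proof -
  have "region {||} nodes"
    using edge_node by (auto simp: region_def)
  then have "proves {||} []"
    by (rule region_proves) (simp add: nodes_def)
  then show ?thesis by (simp add: proves_def sequent_at_def)
qed

end

theorem theorem6p5:
  fixes \<Theta> :: "fm set" and \<Gamma> :: "fm fset" and \<delta> :: fm
    and T :: ptree and \<beta> :: "pos \<rightharpoonup> pos"
  assumes "CHA_proof T \<beta>"
    and "concl T = (\<Gamma> \<turnstile> \<delta>)"
    and "\<And>p \<Gamma>' \<delta>'. p \<in> dom \<beta> \<union> ran \<beta> \<Longrightarrow> sequent_at T p = (\<Gamma>' \<turnstile> \<delta>') \<Longrightarrow>
      fset \<Gamma>' \<union> {\<delta>'} \<subseteq> \<Theta>"
  shows "\<exists>H. HA_proof H \<and> concl H = (\<Gamma> \<turnstile> \<delta>) \<and>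
    (\<forall>\<phi> \<in> induction_formulas H. \<phi> \<in> Pi_closure (sequent_formulas \<Theta>) \<or> \<phi> \<in> Delta0)"
proof -
  interpret restricted_CHA_proof "Pi_closure (sequent_formulas \<Theta>) \<union> Delta0" T \<beta> \<Theta>
  proof
    fix q assume q: "q \<in> ran \<beta>"
    obtain \<Gamma>' \<delta>' where S: "sequent_at T q = (\<Gamma>' \<turnstile> \<delta>')" by fastforce
    then have "fset \<Gamma>' \<union> {\<delta>'} \<subseteq> \<Theta>" using assms(3) q by blast
    then show "sequent_formula (sequent_at T q) \<in> sequent_formulas \<Theta>"
      unfolding S sequent_formula_def sequent_formulas_def by auto
  qed (use assms(1) in auto)
  have "derivable (Pi_closure (sequent_formulas \<Theta>) \<union> Delta0) (\<Gamma> \<turnstile> \<delta>)"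
    using root_proves assms(2) by simp
  from derivable_HA_proof[OF this] show ?thesis by blast
qed

end
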